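(* For every $(\alpha,\beta)\in\mathcal D_1$, every integer $n\geq1$, and every $1\leq k\leq n$, \[ n\,\theta_{n,k}^{(\alpha,\beta)}<(n+1)\,\theta_{n+1,k}^{(\alpha,\beta)}, \] where \[ \mathcal D_1=\left\{(\alpha,\beta)\in(-1,\infty)^2:\ |\beta|\leq\tfrac12,\ \alpha+\beta+1\geq0\right\}\setminus\left\{\left(-\tfrac12,-\tfrac12\right)\right\}. \]
   Context: $P_n^{(\alpha,\beta)}$ denotes the Jacobi polynomial of degree $n$ (orthogonal on $(-1,1)$ with respect to the weight $(1-x)^\alpha(1+x)^\beta$). For $\alpha,\beta>-1$ its $n$ zeros are simple and lie in $(-1,1)$; they are written $\cos\theta_{n,k}^{(\alpha,\beta)}$, $1\le k\le n$, with $0<\theta_{n,1}^{(\alpha,\beta)}<\cdots<\theta_{n,n}^{(\alpha,\beta)}<\pi$. *)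

theory Defs
  imports "HOL-Analysis.Analysis" "HOL-Computational_Algebra.Polynomial"
begin

(* For \<alpha>, \<beta> > -1 the integrand is integrable for all polynomials p and q, so the totality of
   the Bochner integral (value 0 for non-integrable functions) plays no role in that range. *)
definition jacobi_inner :: "real \<Rightarrow> real \<Rightarrow> real poly \<Rightarrow> real poly \<Rightarrow> real" where
  "jacobi_inner \<alpha> \<beta> p q =
     (LBINT x:{-1<..<1}. (1 - x) powr \<alpha> * (1 + x) powr \<beta> * poly p x * poly q x)"

(* Orthogonality determines the polynomial of degree n up to a nonzero factor; the value at 1
   is the usual normalisation. It does not affect the zeros. *)
definition is_jacobi_poly :: "real \<Rightarrow> real \<Rightarrow> nat \<Rightarrow> real poly \<Rightarrow> bool" where
  "is_jacobi_poly \<alpha> \<beta> n p \<longleftrightarrow>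
     p \<noteq> 0 \<and> degree p = n \<and>
     (\<forall>q. q \<noteq> 0 \<and> degree q < n \<longrightarrow> jacobi_inner \<alpha> \<beta> p q = 0) \<and>
     poly p 1 = (real n + \<alpha>) gchoose n"

(* Meaningful for \<alpha>, \<beta> > -1, where the polynomial exists and is unique. *)
definition jacobi_poly :: "real \<Rightarrow> real \<Rightarrow> nat \<Rightarrow> real poly" where
  "jacobi_poly \<alpha> \<beta> n = (THE p. is_jacobi_poly \<alpha> \<beta> n p)"

(* The k-th smallest angle, counted from k = 1, whose cosine is a zero of the Jacobi polynomial;
   for \<alpha>, \<beta> > -1 there are exactly n such angles, so k ranges over 1, ..., n. *)
definition jacobi_theta :: "real \<Rightarrow> real \<Rightarrow> nat \<Rightarrow> nat \<Rightarrow> real" where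
  "jacobi_theta \<alpha> \<beta> n k =
     sorted_list_of_set {\<theta> \<in> {0<..<pi}. poly (jacobi_poly \<alpha> \<beta> n) (cos \<theta>) = 0} ! (k - 1)"

definition D1 :: "(real \<times> real) set" where
  "D1 = {(\<alpha>, \<beta>). -1 < \<alpha> \<and> -1 < \<beta> \<and> \<bar>\<beta>\<bar> \<le> 1/2 \<and> \<alpha> + \<beta> + 1 \<ge> 0} - {(-1/2, -1/2)}"

end

theory Submission
  imports Defs "HOL-Real_Asymp.Real_Asymp"
begin

text \<open>
  Put \<open>s = 1/n\<close>, \<open>x = n \<theta>\<close> and \<open>c = (\<alpha> + \<beta> + 1)/2\<close>. Liouville's substitution
  \<open>u(\<theta>) = (sin (\<theta>/2)) powr (\<alpha> + 1/2) * (cos (\<theta>/2)) powr (\<beta> + 1/2) * P_n (cos \<theta>)\<close> removes the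
  first-order term of the Jacobi equation, and in the stretched variable \<open>x\<close> the result reads
  \<open>u'' + G(s, x) u = 0\<close> with
  \<open>G(s, x) = (1 + c s)^2 + (1/4 - \<alpha>^2) s^2 / (4 sin^2 (s x/2)) + (1/4 - \<beta>^2) s^2 / (4 cos^2 (s x/2))\<close>.
  The zeros in \<open>x\<close> are the numbers \<open>n \<theta>_{n,k}\<close> of the theorem. On \<open>D1\<close> the function \<open>G\<close> increases
  strictly with \<open>s\<close>, so the equation of degree \<open>n\<close> oscillates strictly faster than that of degree
  \<open>n + 1\<close>, and Sturm's comparison theorem places a zero of the former in the interval from \<open>0\<close> to the
  first zero of the latter and between any two consecutive zeros of the latter. Hence at least \<open>k\<close>
  zeros of the former lie strictly below the \<open>k\<close>-th zero of the latter. The comparison is confined to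
  \<open>x < n \<pi>\<close>; if the \<open>k\<close>-th zero of the latter lies beyond that point there is nothing to prove, since
  \<open>\<theta>_{n,k} < \<pi>\<close>.

  Two points need care. The first is the singular endpoint \<open>x = 0\<close>, where \<open>u\<close> behaves like
  \<open>x powr (\<alpha> + 1/2)\<close> and may be unbounded: the Wronskian of the two solutions is nevertheless
  \<open>O(x powr (2 \<alpha> + 2))\<close>, because the leading terms of the two logarithmic derivatives cancel, and this
  tends to \<open>0\<close> for \<open>\<alpha> > -1\<close> (\<open>wronskian_limit_0\<close>). The second is the monotonicity of \<open>G\<close>. It is plain for
  \<open>\<bar>\<alpha>\<bar> \<le> 1/2\<close>, and for \<open>\<bar>\<alpha>\<bar> > 1/2\<close> the negative coefficient \<open>1/4 - \<alpha>^2\<close> must be compensated by the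
  other two terms (\<open>potential_slope_pos\<close>). At the point \<open>(-1/2, -1/2)\<close>, which is left out of \<open>D1\<close>, \<open>G\<close> is
  identically \<open>1\<close>: these are the Chebyshev polynomials, whose zeros satisfy \<open>n \<theta>_{n,k} = (k - 1/2) \<pi>\<close>.

  Since the Jacobi polynomials are given by orthogonality, their differential equation has to be derived
  first. A polynomial solution of degree \<open>n\<close> is written down explicitly
  (\<open>jacobi_ode_solution\<close>); it is orthogonal to all lower degrees because the differential operator is
  symmetric for the weight (\<open>jacobi_op_symmetric\<close>); and orthogonality with the normalisation at \<open>1\<close>
  determines the polynomial. The same orthogonality gives the count of \<open>n\<close> zeros in
  \<open>(-1, 1)\<close> (\<open>jacobi_poly_roots\<close>).
\<close>

section \<open>The Jacobi differential operator and its polynomial eigenfunctions\<close>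

definition jacobi_op :: "real \<Rightarrow> real \<Rightarrow> real poly \<Rightarrow> real poly" where
  "jacobi_op \<alpha> \<beta> p =
     [:1, 0, -1:] * pderiv (pderiv p) + [:\<beta> - \<alpha>, -(\<alpha> + \<beta> + 2):] * pderiv p"

definition jacobi_eigenvalue :: "real \<Rightarrow> real \<Rightarrow> nat \<Rightarrow> real" where
  "jacobi_eigenvalue \<alpha> \<beta> n = real n * (real n + \<alpha> + \<beta> + 1)"

lemma jacobi_eigenvalue_less:
  assumes "\<alpha> > -1" "\<beta> > -1" "k < n"
  shows "jacobi_eigenvalue \<alpha> \<beta> k < jacobi_eigenvalue \<alpha> \<beta> n"
proof -
  have "jacobi_eigenvalue \<alpha> \<beta> n - jacobi_eigenvalue \<alpha> \<beta> k = (real n - real k) * (real n + real k + \<alpha> + \<beta> + 1)"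
    by (simp add: jacobi_eigenvalue_def algebra_simps)
  moreover have "real n + real k + \<alpha> + \<beta> + 1 > 0" using assms by linarith
  ultimately show ?thesis using assms by (smt (verit) mult_pos_pos of_nat_less_iff)
qed

text \<open>
  In powers of \<open>x - 1\<close> the operator sends \<open>(x - 1)^k\<close> to a combination of \<open>(x - 1)^k\<close> and
  \<open>(x - 1)^(k-1)\<close> only, so that an eigenfunction is found from a two-term recursion.
\<close>

lemma jacobi_op_shift:
  "jacobi_op \<alpha> \<beta> (pcompose q [:-1, 1:]) =
     pcompose ([:0, -2, -1:] * pderiv (pderiv q) + [:-2*\<alpha> - 2, -(\<alpha> + \<beta> + 2):] * pderiv q) [:-1, 1:]"
  unfolding jacobi_op_def poly_eq_poly_eq_iff[symmetric] fun_eq_iff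
  by (simp add: poly_pcompose pderiv_pcompose pderiv_pCons algebra_simps)

text \<open>
  The recursion for the coefficients in powers of \<open>x - 1\<close> never divides by zero since \<open>\<alpha> > -1\<close>, and it breaks
  off exactly after \<open>n\<close> steps because the eigenvalues are distinct. The constant coefficient is free; it is
  the value at \<open>1\<close>.
\<close>

lemma jacobi_ode_solution:
  assumes "\<alpha> > -1" "\<beta> > -1"
  obtains p where "degree p = n" "jacobi_op \<alpha> \<beta> p = smult (- jacobi_eigenvalue \<alpha> \<beta> n) p"
    "poly p 1 = (real n + \<alpha>) gchoose n" "poly p 1 \<noteq> 0"
proof -
  let ?l = "jacobi_eigenvalue \<alpha> \<beta>"
  define C where "C = (real n + \<alpha>) gchoose n"
  define c where "c k = C * (\<Prod>j<k. (?l n - ?l j) / (2 * (real j + 1) * (real j + 1 + \<alpha>)))" for k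
  have C: "C \<noteq> 0"
    using assms unfolding C_def gbinomial_prod_rev by (auto simp: prod_zero_iff)
  have rec: "2 * (real k + 1) * (real k + 1 + \<alpha>) * c (Suc k) = (?l n - ?l k) * c k" for k
  proof -
    have "c (Suc k) = c k * ((?l n - ?l k) / (2 * (real k + 1) * (real k + 1 + \<alpha>)))"
      by (simp add: c_def mult_ac)
    then show ?thesis using assms by simp
  qed
  have c_high: "c k = 0" if "k > n" for k
    using that by (auto simp: c_def intro!: bexI[of _ n])
  have c_n: "c n \<noteq> 0"
    using C assms jacobi_eigenvalue_less[OF assms, of _ n] by (force simp: c_def)
  define q where "q = (\<Sum>k\<le>n. monom (c k) k)"
  have coeff_q: "coeff q k = c k" for k
    using c_high by (auto simp: q_def coeff_sum not_le)
  have deg_q: "degree q = n"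
    by (rule antisym[OF degree_le le_degree]) (use c_high c_n in \<open>auto simp: coeff_q\<close>)
  have ode: "[:0, -2, -1:] * pderiv (pderiv q) + [:-2*\<alpha> - 2, -(\<alpha> + \<beta> + 2):] * pderiv q = smult (- ?l n) q"
  proof (rule poly_eqI)
    fix k
    show "coeff ([:0, -2, -1:] * pderiv (pderiv q) + [:-2*\<alpha> - 2, -(\<alpha> + \<beta> + 2):] * pderiv q) k
        = coeff (smult (- ?l n) q) k"
    proof (cases k)
      case 0
      then show ?thesis using rec[of 0] by (simp add: coeff_pderiv coeff_q jacobi_eigenvalue_def algebra_simps)
    next
      case (Suc m)
      show ?thesis
      proof (cases m)
        case 0
        then show ?thesis using Suc rec[of k]
          by (simp add: coeff_pderiv coeff_q jacobi_eigenvalue_def algebra_simps)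
      next
        case (Suc r)
        then show ?thesis using \<open>k = Suc m\<close> rec[of k]
          by (simp add: coeff_pderiv coeff_q jacobi_eigenvalue_def algebra_simps)
      qed
    qed
  qed
  show ?thesis
  proof
    show "degree (pcompose q [:-1,1:]) = n" by (simp add: degree_pcompose deg_q)
    show "jacobi_op \<alpha> \<beta> (pcompose q [:-1,1:]) = smult (- ?l n) (pcompose q [:-1,1:])"
      unfolding jacobi_op_shift ode by (simp only: pcompose_smult)
    have "poly (pcompose q [:-1,1:]) 1 = C"
      by (simp add: poly_pcompose poly_0_coeff_0 coeff_q c_def)
    then show "poly (pcompose q [:-1,1:]) 1 = (real n + \<alpha>) gchoose n"
      "poly (pcompose q [:-1,1:]) 1 \<noteq> 0" using C by (simp_all add: C_def)
  qed
qed

section \<open>Orthogonality of the eigenfunctions\<close>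

abbreviation jacobi_weight :: "real \<Rightarrow> real \<Rightarrow> real \<Rightarrow> real" where
  "jacobi_weight \<alpha> \<beta> x \<equiv> (1 - x) powr \<alpha> * (1 + x) powr \<beta>"

text \<open>
  The substitution \<open>t = (1 + x)/2\<close> turns the weight into the integrand of the Beta function.
\<close>

lemma jacobi_weight_integrable:
  assumes "\<alpha> > -1" "\<beta> > -1"
  shows "set_integrable lborel {-1<..<1} (jacobi_weight \<alpha> \<beta>)"
proof -
  let ?f = "\<lambda>t::real. t powr \<beta> * (1 - t) powr \<alpha>"
  have "(?f has_integral Beta (\<beta> + 1) (\<alpha> + 1)) (cbox 0 1)"
    using has_integral_Beta_real[of "\<beta> + 1" "\<alpha> + 1"] assms by simp
  from has_integral_affinity[OF this, of "1/2" "1/2"]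
  have "(\<lambda>x. ?f (x/2 + 1/2)) integrable_on ((\<lambda>x::real. 2 * x - 1) ` cbox 0 1)"
    by (auto simp: integrable_on_def)
  also have "(\<lambda>x::real. 2 * x - 1) ` cbox 0 1 = {-1..1}"
    using image_affinity_atLeastAtMost[of 2 "-1" 0 "1::real"] by simp
  finally have "(\<lambda>x. ?f (x/2 + 1/2)) integrable_on {-1<..<1}"
    by (simp add: integrable_on_Icc_iff_Ioo)
  then have "(\<lambda>x. 2 powr (\<alpha> + \<beta>) * ?f (x/2 + 1/2)) integrable_on {-1<..<1}"
    using integrable_cmul[of _ _ "2 powr (\<alpha> + \<beta>)"] by simp
  also have "?this \<longleftrightarrow> jacobi_weight \<alpha> \<beta> integrable_on {-1<..<1}"
  proof (rule integrable_cong)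
    fix x :: real assume "x \<in> {-1<..<1}"
    moreover have "x/2 + 1/2 = (1+x)/2" "1 - (x/2 + 1/2) = (1-x)/2" by (simp_all add: field_simps)
    ultimately show "2 powr (\<alpha> + \<beta>) * ?f (x/2 + 1/2) = jacobi_weight \<alpha> \<beta> x"
      by (simp only: powr_divide) (simp add: powr_add)
  qed
  finally have "jacobi_weight \<alpha> \<beta> absolutely_integrable_on {-1<..<1}"
    by (rule nonnegative_absolutely_integrable_1) auto
  then show ?thesis
    unfolding set_integrable_def by (subst (asm) integrable_completion) auto
qed

lemma jacobi_weight_poly_integrable:
  assumes "\<alpha> > -1" "\<beta> > -1"
  shows "set_integrable lborel {-1<..<1} (\<lambda>x. jacobi_weight \<alpha> \<beta> x * poly p x)"
proof -
  have "compact (poly p ` {-1..1})"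
    by (intro compact_continuous_image continuous_intros) auto
  then obtain B where B: "\<forall>x\<in>{-1..1}. \<bar>poly p x\<bar> \<le> B"
    by (auto dest!: compact_imp_bounded simp: bounded_iff)
  have "set_integrable lborel {-1<..<1} (\<lambda>x. B * jacobi_weight \<alpha> \<beta> x)"
    using jacobi_weight_integrable[OF assms] by (rule set_integrable_mult_right)
  then show ?thesis
    unfolding set_integrable_def
  proof (rule Bochner_Integration.integrable_bound)
    show "(\<lambda>x. indicator {-1<..<1} x *\<^sub>R (jacobi_weight \<alpha> \<beta> x * poly p x)) \<in> borel_measurable lborel"
      by (intro borel_measurable_scaleR borel_measurable_times)
         (auto intro!: borel_measurable_continuous_onI continuous_intros)
    show "AE x in lborel. norm (indicator {-1<..<1} x *\<^sub>R (jacobi_weight \<alpha> \<beta> x * poly p x))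
        \<le> norm (indicator {-1<..<1} x *\<^sub>R (B * jacobi_weight \<alpha> \<beta> x))"
    proof (rule AE_I2)
      fix x :: real
      show "norm (indicator {-1<..<1} x *\<^sub>R (jacobi_weight \<alpha> \<beta> x * poly p x))
        \<le> norm (indicator {-1<..<1} x *\<^sub>R (B * jacobi_weight \<alpha> \<beta> x))"
        using B[rule_format, of x] by (auto simp: indicator_def abs_mult mult_ac intro!: mult_left_mono)
    qed
  qed
qed

lemma jacobi_inner_eq:
  "jacobi_inner \<alpha> \<beta> p q = (LBINT x:{-1<..<1}. jacobi_weight \<alpha> \<beta> x * poly (p * q) x)"
  by (simp add: jacobi_inner_def mult_ac)

lemma jacobi_inner_add_right:
  assumes "\<alpha> > -1" "\<beta> > -1"
  shows "jacobi_inner \<alpha> \<beta> p (q + r) = jacobi_inner \<alpha> \<beta> p q + jacobi_inner \<alpha> \<beta> p r"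
proof -
  have "poly (p * (q + r)) x = poly (p * q) x + poly (p * r) x" for x
    by (simp add: algebra_simps)
  then show ?thesis
    unfolding jacobi_inner_eq
    by (subst set_integral_add(2)[symmetric, OF jacobi_weight_poly_integrable jacobi_weight_poly_integrable])
       (simp_all only: assms distrib_left)
qed

lemma jacobi_inner_smult_right: "jacobi_inner \<alpha> \<beta> p (smult c q) = c * jacobi_inner \<alpha> \<beta> p q"
  unfolding jacobi_inner_eq by (subst set_integral_mult_right[symmetric]) (simp add: mult_ac)

lemma jacobi_inner_commute: "jacobi_inner \<alpha> \<beta> p q = jacobi_inner \<alpha> \<beta> q p"
  by (simp add: jacobi_inner_eq mult.commute)

text \<open>
  Lagrange's identity: \<open>w (L p \<cdot> q - p \<cdot> L q)\<close> is the derivative of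
  \<open>(1 - x) powr (\<alpha> + 1) * (1 + x) powr (\<beta> + 1) * (p' q - p q')\<close>. This function is continuous on the closed
  interval and vanishes at both endpoints because both exponents are positive.
\<close>

lemma jacobi_op_symmetric:
  assumes "\<alpha> > -1" "\<beta> > -1"
  shows "jacobi_inner \<alpha> \<beta> (jacobi_op \<alpha> \<beta> p) q = jacobi_inner \<alpha> \<beta> p (jacobi_op \<alpha> \<beta> q)"
proof -
  define r where "r = pderiv p * q - p * pderiv q"
  define s where "s = jacobi_op \<alpha> \<beta> p * q - p * jacobi_op \<alpha> \<beta> q"
  let ?F = "\<lambda>x. jacobi_weight (\<alpha> + 1) (\<beta> + 1) x * poly r x"
  have "((\<lambda>x. jacobi_weight \<alpha> \<beta> x * poly s x) has_integral (?F 1 - ?F (-1))) {-1..1}"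
  proof (rule fundamental_theorem_of_calculus_interior)
    show "continuous_on {-1..1} ?F"
      using assms by (intro continuous_intros continuous_on_powr') auto
    fix x :: real assume x: "x \<in> {-1<..<1}"
    have "(?F has_real_derivative
        (- ((\<alpha> + 1) * (1 - x) powr \<alpha>) * (1 + x) powr (\<beta> + 1)
          + (1 - x) powr (\<alpha> + 1) * ((\<beta> + 1) * (1 + x) powr \<beta>)) * poly r x
        + jacobi_weight (\<alpha> + 1) (\<beta> + 1) x * poly (pderiv r) x) (at x)"
      using x by (auto intro!: derivative_eq_intros)
    also have "(- ((\<alpha> + 1) * (1 - x) powr \<alpha>) * (1 + x) powr (\<beta> + 1)
          + (1 - x) powr (\<alpha> + 1) * ((\<beta> + 1) * (1 + x) powr \<beta>)) * poly r x
        + jacobi_weight (\<alpha> + 1) (\<beta> + 1) x * poly (pderiv r) x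
      = jacobi_weight \<alpha> \<beta> x * poly s x"
      using x by (simp add: powr_add r_def s_def jacobi_op_def pderiv_mult pderiv_diff algebra_simps)
    finally show "(?F has_vector_derivative (jacobi_weight \<alpha> \<beta> x * poly s x)) (at x)"
      by (simp add: has_real_derivative_iff_has_vector_derivative)
  qed simp
  then have "((\<lambda>x. jacobi_weight \<alpha> \<beta> x * poly s x) has_integral 0) {-1<..<1}"
    using assms by (simp add: has_integral_Icc_iff_Ioo)
  then have "(LBINT x:{-1<..<1}. jacobi_weight \<alpha> \<beta> x * poly s x) = 0"
    using set_borel_integral_eq_integral(2)[OF jacobi_weight_poly_integrable[OF assms, of s]]
    by (simp add: integral_unique)
  moreover have "poly s x = poly (jacobi_op \<alpha> \<beta> p * q) x - poly (p * jacobi_op \<alpha> \<beta> q) x" for x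
    by (simp add: s_def)
  then have "jacobi_inner \<alpha> \<beta> (jacobi_op \<alpha> \<beta> p) q - jacobi_inner \<alpha> \<beta> p (jacobi_op \<alpha> \<beta> q)
      = (LBINT x:{-1<..<1}. jacobi_weight \<alpha> \<beta> x * poly s x)"
    unfolding jacobi_inner_eq
    by (subst set_integral_diff(2)[symmetric, OF jacobi_weight_poly_integrable jacobi_weight_poly_integrable])
       (simp_all only: assms right_diff_distrib)
  ultimately show ?thesis by simp
qed

text \<open>
  The operator is triangular with respect to the degree.
\<close>

lemma jacobi_op_degree:
  fixes \<alpha> \<beta> :: real
  assumes "q \<noteq> 0"
  defines "r \<equiv> jacobi_op \<alpha> \<beta> q + smult (jacobi_eigenvalue \<alpha> \<beta> (degree q)) q"
  shows "r = 0 \<or> degree r < degree q"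
proof -
  obtain d where d: "degree q = d" by simp
  have "coeff r k = 0" if "k \<ge> d" for k
  proof -
    have z: "coeff q (Suc k) = 0" "coeff q (Suc (Suc k)) = 0" "k = d \<or> coeff q k = 0"
      using that d by (auto intro!: coeff_eq_0)
    consider "k = 0" | "k = 1" | j where "k = Suc (Suc j)" by (metis One_nat_def not0_implies_Suc)
    then show ?thesis
      using z by cases (auto simp: r_def d jacobi_op_def coeff_pderiv jacobi_eigenvalue_def algebra_simps)
  qed
  then show ?thesis
    unfolding d by (metis leading_coeff_0_iff not_le)
qed

text \<open>
  Induction on the degree \<open>d\<close> of \<open>q\<close>. Modulo lower degrees \<open>q\<close> is an eigenfunction for \<open>d\<close>, so by symmetry
  and the induction hypothesis the inner product is annihilated by the difference of the eigenvalues for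
  \<open>d\<close> and \<open>n\<close>, which is not zero.
\<close>

lemma jacobi_ode_orthogonal:
  assumes "\<alpha> > -1" "\<beta> > -1"
    and ode: "jacobi_op \<alpha> \<beta> p = smult (- jacobi_eigenvalue \<alpha> \<beta> n) p"
    and "q = 0 \<or> degree q < n"
  shows "jacobi_inner \<alpha> \<beta> p q = 0"
  using assms(4)
proof (induction "degree q" arbitrary: q rule: less_induct)
  case less
  let ?I = "jacobi_inner \<alpha> \<beta>" and ?l = "jacobi_eigenvalue \<alpha> \<beta>"
  show ?case
  proof (cases "q = 0")
    case True
    then show ?thesis by (simp add: jacobi_inner_def)
  next
    case False
    define r where "r = jacobi_op \<alpha> \<beta> q + smult (?l (degree q)) q"
    have d: "degree q < n" using False less.prems by simp
    have r: "r = 0 \<or> degree r < degree q" unfolding r_def by (rule jacobi_op_degree[OF False])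
    have "?I p r = 0"
      using r less.hyps[of r] d by (cases "r = 0") (auto simp: jacobi_inner_def)
    moreover have "?I p r = ?I (jacobi_op \<alpha> \<beta> p) q + ?l (degree q) * ?I p q"
      unfolding r_def jacobi_inner_add_right[OF assms(1,2)] jacobi_op_symmetric[OF assms(1,2)]
      by (simp add: jacobi_inner_smult_right)
    moreover have "?I (jacobi_op \<alpha> \<beta> p) q = - ?l n * ?I p q"
      unfolding ode by (subst (1 2) jacobi_inner_commute) (simp only: jacobi_inner_smult_right)
    ultimately have "(?l (degree q) - ?l n) * ?I p q = 0" by (simp add: algebra_simps)
    then show ?thesis using jacobi_eigenvalue_less[OF assms(1,2) d] by simp
  qed
qed

lemma jacobi_inner_nonzero:
  assumes "\<alpha> > -1" "\<beta> > -1" "p * q \<noteq> 0" "\<And>x. x \<in> {-1<..<1} \<Longrightarrow> poly (p * q) x \<ge> 0"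
  shows "jacobi_inner \<alpha> \<beta> p q \<noteq> 0"
proof
  assume "jacobi_inner \<alpha> \<beta> p q = 0"
  let ?f = "\<lambda>x. indicator {-1<..<1} x *\<^sub>R (jacobi_weight \<alpha> \<beta> x * poly (p * q) x)"
  have "integrable lborel ?f"
    using jacobi_weight_poly_integrable[OF assms(1,2), of "p * q"] by (simp only: set_integrable_def)
  moreover have "AE x in lborel. 0 \<le> ?f x"
    using assms(4) by (intro AE_I2) (auto simp: indicator_def simp del: poly_mult)
  moreover have "integral\<^sup>L lborel ?f = 0"
    using \<open>jacobi_inner \<alpha> \<beta> p q = 0\<close> unfolding jacobi_inner_eq set_lebesgue_integral_def .
  ultimately have ae: "AE x in lborel. ?f x = 0"
    using integral_nonneg_eq_0_iff_AE by blast
  have "finite {x. poly (p * q) x = 0}" using assms(3) by (rule poly_roots_finite)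
  then have "{x. poly (p * q) x = 0} \<in> null_sets lborel" by (rule finite_imp_null_set_lborel)
  then have "AE x in lborel. x \<notin> {x. poly (p * q) x = 0}" by (rule AE_not_in)
  with ae have "AE x in lborel. x \<notin> {-1<..<1::real}"
    by eventually_elim (auto simp: indicator_def split: if_splits)
  then have "{-1<..<1::real} \<in> null_sets lborel"
    by (subst (asm) AE_iff_null_sets[symmetric]) auto
  then show False by (simp add: null_sets_def)
qed

text \<open>
  Subtracting the multiple of \<open>q\<close> with the same leading coefficient leaves a polynomial \<open>d\<close> of degree below \<open>n\<close>.
  It is orthogonal to \<open>p\<close> and \<open>q\<close>, hence to itself, hence zero; the value at \<open>1\<close> then fixes the factor.
\<close>

lemma is_jacobi_poly_unique:
  assumes "\<alpha> > -1" "\<beta> > -1" and p: "is_jacobi_poly \<alpha> \<beta> n p" and q: "is_jacobi_poly \<alpha> \<beta> n q"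
    and nz: "poly p 1 \<noteq> 0"
  shows "p = q"
proof -
  define c where "c = lead_coeff p / lead_coeff q"
  define d where "d = p - smult c q"
  have pq: "p \<noteq> 0" "q \<noteq> 0" "degree p = n" "degree q = n" using p q by (auto simp: is_jacobi_poly_def)
  then have lc: "coeff p n \<noteq> 0" "coeff q n \<noteq> 0" by (metis leading_coeff_0_iff)+
  then have "coeff d n = 0" using pq by (simp add: d_def c_def)
  moreover have "degree d \<le> n" using pq by (auto simp: d_def intro!: degree_diff_le)
  ultimately have d: "d = 0 \<or> degree d < n"
    by (metis leading_coeff_0_iff le_neq_implies_less)
  have "jacobi_inner \<alpha> \<beta> d d = 0"
  proof (cases "d = 0")
    case False
    then have "jacobi_inner \<alpha> \<beta> d p = 0" "jacobi_inner \<alpha> \<beta> d q = 0"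
      using p q d by (auto simp: is_jacobi_poly_def jacobi_inner_commute[of _ _ d])
    moreover have "d = p + smult (-c) q" by (simp add: d_def)
    ultimately show ?thesis
      using jacobi_inner_add_right[OF assms(1,2), of d p "smult (-c) q"]
      by (simp add: jacobi_inner_smult_right del: smult_minus_left)
  qed (simp add: jacobi_inner_def)
  then have "d = 0" using jacobi_inner_nonzero[OF assms(1,2), of d d] by (auto simp: )
  then have "p = smult c q" by (simp add: d_def)
  moreover have "poly p 1 = poly q 1" using p q by (simp add: is_jacobi_poly_def)
  ultimately show ?thesis using nz by simp
qed

lemma
  assumes "\<alpha> > -1" "\<beta> > -1"
  shows is_jacobi_poly_jacobi_poly: "is_jacobi_poly \<alpha> \<beta> n (jacobi_poly \<alpha> \<beta> n)"
    and jacobi_poly_ode: "jacobi_op \<alpha> \<beta> (jacobi_poly \<alpha> \<beta> n) = smult (- jacobi_eigenvalue \<alpha> \<beta> n) (jacobi_poly \<alpha> \<beta> n)"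
proof -
  obtain p where p: "degree p = n" "jacobi_op \<alpha> \<beta> p = smult (- jacobi_eigenvalue \<alpha> \<beta> n) p"
    "poly p 1 = (real n + \<alpha>) gchoose n" "poly p 1 \<noteq> 0"
    using jacobi_ode_solution[OF assms] .
  then have j: "is_jacobi_poly \<alpha> \<beta> n p"
    unfolding is_jacobi_poly_def using jacobi_ode_orthogonal[OF assms p(2)] by (metis poly_0)
  then have "jacobi_poly \<alpha> \<beta> n = p"
    unfolding jacobi_poly_def
    by (rule the_equality) (rule is_jacobi_poly_unique[OF assms j _ p(4), symmetric])
  then show "is_jacobi_poly \<alpha> \<beta> n (jacobi_poly \<alpha> \<beta> n)"
    "jacobi_op \<alpha> \<beta> (jacobi_poly \<alpha> \<beta> n) = smult (- jacobi_eigenvalue \<alpha> \<beta> n) (jacobi_poly \<alpha> \<beta> n)"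
    using j p(2) by simp_all
qed

section \<open>Zeros of Jacobi polynomials\<close>

text \<open>
  \<open>S\<close> consists of the zeros in \<open>(-1, 1)\<close> of odd multiplicity. It is built by splitting off one linear factor
  after the other: each factor \<open>x - a\<close> adds \<open>a\<close> to \<open>S\<close> or, if \<open>a\<close> is already there, removes it.
\<close>

lemma poly_sign_correction:
  fixes p :: "real poly"
  assumes "p \<noteq> 0"
  obtains S c where "finite S" "S \<subseteq> {x \<in> {-1<..<1}. poly p x = 0}" "c \<noteq> 0"
    "\<And>x. x \<in> {-1<..<1} \<Longrightarrow> c * poly (p * (\<Prod>a\<in>S. [:-a, 1:])) x \<ge> 0"
  using assms
proof (induction "degree p" arbitrary: p thesis rule: less_induct)
  case less
  show ?case
  proof (cases "\<exists>a\<in>{-1<..<1}. poly p a = 0")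
    case False
    have "poly p 0 * poly p x \<ge> 0" if x: "x \<in> {-1<..<1}" for x
    proof (rule ccontr)
      assume neg: "\<not> poly p 0 * poly p x \<ge> 0"
      have "\<exists>y. min 0 x < y \<and> y < max 0 x \<and> poly p y = 0"
        using poly_IVT[of "min 0 x" "max 0 x" p] neg
        by (cases "x < 0"; cases "x = 0") (auto simp: mult.commute min_def max_def not_le)
      then show False using False x by (auto simp: min_def max_def split: if_splits)
    qed
    then show ?thesis using False by (intro less.prems(1)[of "{}" "poly p 0"]) auto
  next
    case True
    then obtain a where a: "a \<in> {-1<..<1}" "poly p a = 0" by blast
    then obtain r where r: "p = [:-a, 1:] * r" by (auto simp: poly_eq_0_iff_dvd)
    with \<open>p \<noteq> 0\<close> have "r \<noteq> 0" by auto
    then have "degree r < degree p" by (simp add: r degree_mult_eq del: mult_pCons_left)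
    then obtain S c where S: "finite S" "S \<subseteq> {x \<in> {-1<..<1}. poly r x = 0}" "c \<noteq> 0"
      and sign: "\<And>x. x \<in> {-1<..<1} \<Longrightarrow> c * poly (r * (\<Prod>a\<in>S. [:-a, 1:])) x \<ge> 0"
      using less.hyps[OF \<open>degree r < degree p\<close> _ \<open>r \<noteq> 0\<close>] by blast
    show ?thesis
    proof (cases "a \<in> S")
      case True
      have "p * (\<Prod>b\<in>S - {a}. [:-b, 1:]) = r * (\<Prod>b\<in>S. [:-b, 1:])"
        using prod.remove[OF S(1) True, of "\<lambda>b. [:-b, 1:]"] by (simp only: r mult_ac)
      then show ?thesis
        using S sign a by (intro less.prems(1)[of "S - {a}" c]) (auto simp: r simp del: poly_mult)
    next
      case False
      have "p * (\<Prod>b\<in>insert a S. [:-b, 1:]) = [:-a, 1:]\<^sup>2 * (r * (\<Prod>b\<in>S. [:-b, 1:]))"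
        by (simp only: r prod.insert[OF S(1) False] power2_eq_square mult_ac)
      moreover have "c * poly ([:-a, 1:]\<^sup>2 * (r * (\<Prod>b\<in>S. [:-b, 1:]))) x \<ge> 0" if "x \<in> {-1<..<1}" for x
        using mult_nonneg_nonneg[OF zero_le_power2[of "x - a"] sign[OF that]]
        by (simp add: mult_ac)
      ultimately show ?thesis
        using S a by (intro less.prems(1)[of "insert a S" c]) (auto simp: r)
    qed
  qed
qed

text \<open>
  With fewer than \<open>n\<close> zeros of odd multiplicity, the product of the corresponding linear factors would be
  orthogonal to the Jacobi polynomial, although it has the same sign as that polynomial, or the opposite
  one, throughout \<open>(-1, 1)\<close>.
\<close>

lemma jacobi_poly_roots:
  assumes "\<alpha> > -1" "\<beta> > -1"
  shows "card {x \<in> {-1<..<1}. poly (jacobi_poly \<alpha> \<beta> n) x = 0} = n"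
proof -
  let ?p = "jacobi_poly \<alpha> \<beta> n"
  let ?R = "{x \<in> {-1<..<1}. poly ?p x = 0}"
  have j: "is_jacobi_poly \<alpha> \<beta> n ?p" by (rule is_jacobi_poly_jacobi_poly[OF assms])
  then have nz: "?p \<noteq> 0" and deg: "degree ?p = n" by (auto simp: is_jacobi_poly_def)
  have fin: "finite {x. poly ?p x = 0}" using nz by (rule poly_roots_finite)
  have "card ?R \<le> card {x. poly ?p x = 0}" using fin by (intro card_mono) auto
  also have "\<dots> \<le> n" using card_poly_roots_bound[OF nz] deg by simp
  finally have le: "card ?R \<le> n" .
  obtain S c where S: "finite S" "S \<subseteq> ?R" "c \<noteq> 0"
    and sign: "\<And>x. x \<in> {-1<..<1} \<Longrightarrow> c * poly (?p * (\<Prod>a\<in>S. [:-a, 1:])) x \<ge> 0"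
    using poly_sign_correction[OF nz] by blast
  let ?q = "\<Prod>a\<in>S. [:-a, 1:]"
  have q: "?q \<noteq> 0" "degree ?q = card S"
    using S(1) by (auto simp: degree_prod_eq_sum_degree)
  have "\<not> card S < n"
  proof
    assume "card S < n"
    then have "jacobi_inner \<alpha> \<beta> ?p (smult c ?q) = 0"
      using j q unfolding jacobi_inner_smult_right by (auto simp: is_jacobi_poly_def)
    moreover have "jacobi_inner \<alpha> \<beta> ?p (smult c ?q) \<noteq> 0"
      using nz q S(3) sign by (intro jacobi_inner_nonzero[OF assms]) auto
    ultimately show False by simp
  qed
  moreover have "card S \<le> card ?R"
    using S(2) by (intro card_mono finite_subset[OF _ fin]) auto
  ultimately show ?thesis using le by simp
qed

definition jacobi_angles :: "real \<Rightarrow> real \<Rightarrow> nat \<Rightarrow> real set" where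
  "jacobi_angles \<alpha> \<beta> n = {\<theta> \<in> {0<..<pi}. poly (jacobi_poly \<alpha> \<beta> n) (cos \<theta>) = 0}"

lemma jacobi_angles_card:
  assumes "\<alpha> > -1" "\<beta> > -1"
  shows "finite (jacobi_angles \<alpha> \<beta> n)" "card (jacobi_angles \<alpha> \<beta> n) = n"
proof -
  let ?R = "{x \<in> {-1<..<1}. poly (jacobi_poly \<alpha> \<beta> n) x = 0}"
  have bij: "bij_betw cos (jacobi_angles \<alpha> \<beta> n) ?R"
    unfolding bij_betw_def
  proof
    show "inj_on cos (jacobi_angles \<alpha> \<beta> n)"
      by (rule inj_onI) (auto simp: jacobi_angles_def intro!: cos_inj_pi)
    show "cos ` jacobi_angles \<alpha> \<beta> n = ?R"
    proof (intro equalityI subsetI)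
      fix x assume "x \<in> cos ` jacobi_angles \<alpha> \<beta> n"
      then show "x \<in> ?R"
        using cos_monotone_0_pi[of 0] cos_monotone_0_pi[of _ pi] by (auto simp: jacobi_angles_def)
    next
      fix x assume x: "x \<in> ?R"
      then have "cos (arccos x) = x" "arccos x \<in> {0<..<pi}"
        using arccos_lt_bounded[of x] by auto
      then show "x \<in> cos ` jacobi_angles \<alpha> \<beta> n"
        using x by (intro image_eqI[of _ _ "arccos x"]) (auto simp: jacobi_angles_def)
    qed
  qed
  have "jacobi_poly \<alpha> \<beta> n \<noteq> 0"
    using is_jacobi_poly_jacobi_poly[OF assms] by (auto simp: is_jacobi_poly_def)
  then have "finite ?R" using poly_roots_finite[of "jacobi_poly \<alpha> \<beta> n"] by auto
  then show "finite (jacobi_angles \<alpha> \<beta> n)" using bij by (simp add: bij_betw_finite)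
  show "card (jacobi_angles \<alpha> \<beta> n) = n"
    using bij_betw_same_card[OF bij] jacobi_poly_roots[OF assms] by simp
qed

section \<open>Sturm comparison with a singular left endpoint\<close>

lemma nonvanishing_same_sign:
  fixes f :: "real \<Rightarrow> real"
  assumes "continuous_on {l<..<r} f" "\<And>x. x \<in> {l<..<r} \<Longrightarrow> f x \<noteq> 0"
  obtains \<sigma> :: real where "\<And>x. x \<in> {l<..<r} \<Longrightarrow> \<sigma> * f x > 0"
proof (cases "l < r")
  case True
  define m where "m = (l + r) / 2"
  have m: "m \<in> {l<..<r}" using True by (simp add: m_def)
  have conn: "connected (f ` {l<..<r})" using assms(1) by (intro connected_continuous_image) auto
  have nz: "0 \<notin> f ` {l<..<r}" using assms(2) by auto
  have "f m * f x > 0" if x: "x \<in> {l<..<r}" for x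
  proof (rule ccontr)
    assume "\<not> f m * f x > 0"
    then have "f m \<le> 0 \<and> 0 \<le> f x \<or> f x \<le> 0 \<and> 0 \<le> f m"
      by (auto simp: zero_less_mult_iff not_less not_le)
    then show False
      using connectedD_interval[OF conn, of "f m" "f x" 0] connectedD_interval[OF conn, of "f x" "f m" 0]
        m x nz by blast
  qed
  then show ?thesis using that by blast
qed (use that in auto)

text \<open>
  The Wronskian \<open>W = u' v - u v'\<close> has the derivative \<open>(G - F) u v < 0\<close>. Starting from a nonpositive limit it is
  negative at \<open>r\<close>; but there it equals \<open>- u r * v' r\<close>, which is nonnegative because \<open>v\<close> falls to zero.
\<close>

lemma sturm_comparison_pos:
  fixes u v u' v' F G :: "real \<Rightarrow> real"
  assumes "l < r"
    and u: "\<And>x. x \<in> {l<..r} \<Longrightarrow> (u has_real_derivative u' x) (at x)"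
    and u': "\<And>x. x \<in> {l<..r} \<Longrightarrow> (u' has_real_derivative - F x * u x) (at x)"
    and v: "\<And>x. x \<in> {l<..r} \<Longrightarrow> (v has_real_derivative v' x) (at x)"
    and v': "\<And>x. x \<in> {l<..r} \<Longrightarrow> (v' has_real_derivative - G x * v x) (at x)"
    and less: "\<And>x. x \<in> {l<..<r} \<Longrightarrow> G x < F x"
    and lim: "((\<lambda>x. u' x * v x - u x * v' x) \<longlongrightarrow> w) (at_right l)" "w \<le> 0"
    and pos: "\<And>x. x \<in> {l<..<r} \<Longrightarrow> u x > 0" "\<And>x. x \<in> {l<..<r} \<Longrightarrow> v x > 0"
    and vr: "v r = 0"
  shows False
proof -
  let ?W = "\<lambda>x. u' x * v x - u x * v' x"
  have W: "(?W has_real_derivative (G x - F x) * (u x * v x)) (at x)" if "x \<in> {l<..r}" for x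
    using u[OF that] u'[OF that] v[OF that] v'[OF that]
    by (auto intro!: derivative_eq_intros simp: algebra_simps)
  have dec: "?W y < ?W x" if "l < x" "x < y" "y \<le> r" for x y
  proof (rule DERIV_neg_imp_decreasing_open[where f = ?W])
    show "x < y" by fact
    show "\<exists>d. (?W has_real_derivative d) (at z) \<and> d < 0" if "x < z" "z < y" for z
      using W[of z] less[of z] pos[of z] that \<open>l < x\<close> \<open>y \<le> r\<close>
      by (intro exI[of _ "(G z - F z) * (u z * v z)"]) (auto intro!: mult_neg_pos)
    show "continuous_on {x..y} ?W"
      using that by (intro DERIV_continuous_on[OF has_field_derivative_at_within[OF W]]) auto
  qed
  define m where "m = (l + r) / 2"
  have m: "l < m" "m < r" using \<open>l < r\<close> by (auto simp: m_def)
  have "eventually (\<lambda>x. ?W m \<le> ?W x) (at_right l)"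
    using eventually_at_right_less[of l] eventually_at_right_real[OF m(1)]
  proof eventually_elim
    case (elim x)
    then show ?case using dec[of x m] m by simp
  qed
  then have "?W m \<le> w" using lim(1) by (intro tendsto_lowerbound) auto
  then have "?W r < 0" using dec[of m r] m \<open>w \<le> 0\<close> by simp
  moreover have "u r \<ge> 0"
  proof (rule tendsto_lowerbound)
    show "(u \<longlongrightarrow> u r) (at_left r)"
      using DERIV_isCont[OF u[of r]] \<open>l < r\<close> by (simp add: isCont_def filterlim_at_split)
    show "eventually (\<lambda>x. 0 \<le> u x) (at_left r)"
      using eventually_at_left_real[OF \<open>l < r\<close>] by eventually_elim (use pos in force)
  qed simp
  moreover have "v' r \<le> 0"
  proof (rule ccontr)
    assume "\<not> v' r \<le> 0"
    then obtain d where d: "d > 0" "\<And>h. 0 < h \<Longrightarrow> h < d \<Longrightarrow> v (r - h) < v r"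
      using DERIV_pos_inc_left[OF v[of r]] \<open>l < r\<close> by auto
    define h where "h = min (d/2) ((r - l)/2)"
    have "0 < h" "h < d" "r - h \<in> {l<..<r}" using d(1) \<open>l < r\<close> by (auto simp: h_def min_def field_simps)
    then show False using d(2)[of h] pos(2)[of "r - h"] vr by simp
  qed
  ultimately show False using vr mult_nonneg_nonpos[of "u r" "v' r"] by simp
qed

text \<open>
  The left endpoint may be a zero of \<open>v\<close> at which both functions are regular, or a singular point at which
  the Wronskian tends to zero. Without a zero both functions have constant sign, and \<open>\<sigma>\<close>, \<open>\<tau>\<close> make them
  positive.
\<close>

theorem sturm_comparison:
  fixes u v u' v' F G :: "real \<Rightarrow> real"
  assumes "l < r"
    and u: "\<And>x. x \<in> {l<..r} \<Longrightarrow> (u has_real_derivative u' x) (at x)"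
    and u': "\<And>x. x \<in> {l<..r} \<Longrightarrow> (u' has_real_derivative - F x * u x) (at x)"
    and v: "\<And>x. x \<in> {l<..r} \<Longrightarrow> (v has_real_derivative v' x) (at x)"
    and v': "\<And>x. x \<in> {l<..r} \<Longrightarrow> (v' has_real_derivative - G x * v x) (at x)"
    and less: "\<And>x. x \<in> {l<..<r} \<Longrightarrow> G x < F x"
    and left: "((\<lambda>x. u' x * v x - u x * v' x) \<longlongrightarrow> 0) (at_right l) \<or>
      v l = 0 \<and> isCont u l \<and> isCont u' l \<and> isCont v' l \<and> (v has_real_derivative v' l) (at l)"
    and vnz: "\<And>x. x \<in> {l<..<r} \<Longrightarrow> v x \<noteq> 0"
    and vr: "v r = 0"
  shows "\<exists>x\<in>{l<..<r}. u x = 0"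
proof (rule ccontr)
  assume unz: "\<not> (\<exists>x\<in>{l<..<r}. u x = 0)"
  have "continuous_on {l<..<r} u"
    by (intro DERIV_continuous_on[OF has_field_derivative_at_within[OF u]]) auto
  then obtain \<sigma> where \<sigma>: "\<And>x. x \<in> {l<..<r} \<Longrightarrow> \<sigma> * u x > 0"
    using nonvanishing_same_sign unz by blast
  have "continuous_on {l<..<r} v"
    by (intro DERIV_continuous_on[OF has_field_derivative_at_within[OF v]]) auto
  then obtain \<tau> where \<tau>: "\<And>x. x \<in> {l<..<r} \<Longrightarrow> \<tau> * v x > 0"
    using nonvanishing_same_sign vnz by blast
  let ?W = "\<lambda>x. (\<sigma> * u' x) * (\<tau> * v x) - (\<sigma> * u x) * (\<tau> * v' x)"
  have W: "?W = (\<lambda>x. (\<sigma> * \<tau>) * (u' x * v x - u x * v' x))"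
    by (simp add: fun_eq_iff algebra_simps)
  have "\<exists>w\<le>0. (?W \<longlongrightarrow> w) (at_right l)"
    using left
  proof
    assume "((\<lambda>x. u' x * v x - u x * v' x) \<longlongrightarrow> 0) (at_right l)"
    from tendsto_mult_left[OF this, of "\<sigma> * \<tau>"] show ?thesis
      unfolding W by (intro exI[of _ 0]) simp
  next
    assume l: "v l = 0 \<and> isCont u l \<and> isCont u' l \<and> isCont v' l \<and> (v has_real_derivative v' l) (at l)"
    have cont: "isCont ?W l"
      using l DERIV_isCont[of v "v' l" l] by (intro continuous_intros) auto
    have "\<sigma> * u l \<ge> 0"
    proof (rule tendsto_lowerbound)
      have "isCont (\<lambda>x. \<sigma> * u x) l" using l by (intro continuous_intros) auto
      then show "((\<lambda>x. \<sigma> * u x) \<longlongrightarrow> \<sigma> * u l) (at_right l)"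
        by (simp add: isCont_def filterlim_at_split)
      show "eventually (\<lambda>x. 0 \<le> \<sigma> * u x) (at_right l)"
        using eventually_at_right_real[OF \<open>l < r\<close>] by eventually_elim (use \<sigma> in force)
    qed simp
    moreover have "\<tau> * v' l \<ge> 0"
    proof (rule ccontr)
      assume neg: "\<not> \<tau> * v' l \<ge> 0"
      have "((\<lambda>x. \<tau> * v x) has_real_derivative \<tau> * v' l) (at l)"
        using l by (auto intro!: derivative_eq_intros)
      from DERIV_neg_dec_right[OF this] neg obtain d where
        d: "d > 0" "\<And>h. 0 < h \<Longrightarrow> h < d \<Longrightarrow> \<tau> * v (l + h) < \<tau> * v l" by auto
      define h where "h = min (d/2) ((r - l)/2)"
      have "0 < h" "h < d" "l + h \<in> {l<..<r}" using d(1) \<open>l < r\<close> by (auto simp: h_def min_def field_simps)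
      then show False using d(2)[of h] \<tau>[of "l + h"] l by simp
    qed
    ultimately have "?W l \<le> 0" using l by simp
    moreover have "(?W \<longlongrightarrow> ?W l) (at_right l)"
      using cont by (simp add: isCont_def filterlim_at_split)
    ultimately show ?thesis by blast
  qed
  then obtain w where w: "w \<le> 0" "(?W \<longlongrightarrow> w) (at_right l)" by blast
  show False
  proof (rule sturm_comparison_pos[where u = "\<lambda>x. \<sigma> * u x" and v = "\<lambda>x. \<tau> * v x"
        and F = F and G = G, OF \<open>l < r\<close> _ _ _ _ less w(2,1)])
    fix x assume x: "x \<in> {l<..r}"
    show "((\<lambda>x. \<sigma> * u x) has_real_derivative \<sigma> * u' x) (at x)"
      using u[OF x] by (auto intro!: derivative_eq_intros)
    show "((\<lambda>x. \<sigma> * u' x) has_real_derivative - F x * (\<sigma> * u x)) (at x)"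
      using u'[OF x] by (auto intro!: derivative_eq_intros)
    show "((\<lambda>x. \<tau> * v x) has_real_derivative \<tau> * v' x) (at x)"
      using v[OF x] by (auto intro!: derivative_eq_intros)
    show "((\<lambda>x. \<tau> * v' x) has_real_derivative - G x * (\<tau> * v x)) (at x)"
      using v'[OF x] by (auto intro!: derivative_eq_intros)
  qed (use \<sigma> \<tau> vr in auto)
qed

section \<open>Liouville normal form\<close>

lemma jacobi_ode_cos:
  assumes "jacobi_op \<alpha> \<beta> p = smult (- l) p"
  shows "(sin \<theta>)\<^sup>2 * poly (pderiv (pderiv p)) (cos \<theta>)
      + (\<beta> - \<alpha> - (\<alpha> + \<beta> + 2) * cos \<theta>) * poly (pderiv p) (cos \<theta>) + l * poly p (cos \<theta>) = 0"
proof -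
  have "poly (jacobi_op \<alpha> \<beta> p) (cos \<theta>) = - l * poly p (cos \<theta>)" by (simp add: assms)
  moreover have "poly (jacobi_op \<alpha> \<beta> p) (cos \<theta>) = (1 - cos \<theta> * cos \<theta>) * poly (pderiv (pderiv p)) (cos \<theta>)
      + (\<beta> - \<alpha> - (\<alpha> + \<beta> + 2) * cos \<theta>) * poly (pderiv p) (cos \<theta>)"
    by (simp add: jacobi_op_def algebra_simps)
  moreover have "(sin \<theta>)\<^sup>2 = 1 - cos \<theta> * cos \<theta>"
    using sin_squared_eq[of \<theta>] by (simp add: power2_eq_square)
  ultimately show ?thesis by (simp only:)
qed

definition liouville_factor :: "real \<Rightarrow> real \<Rightarrow> real \<Rightarrow> real" where
  "liouville_factor \<alpha> \<beta> \<theta> = sin (\<theta> / 2) powr (\<alpha> + 1/2) * cos (\<theta> / 2) powr (\<beta> + 1/2)"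

definition liouville_logderiv :: "real \<Rightarrow> real \<Rightarrow> real \<Rightarrow> real" where
  "liouville_logderiv \<alpha> \<beta> \<theta> = ((\<alpha> + 1/2) * cot (\<theta> / 2) - (\<beta> + 1/2) * tan (\<theta> / 2)) / 2"

definition liouville :: "real \<Rightarrow> real \<Rightarrow> real poly \<Rightarrow> real \<Rightarrow> real" where
  "liouville \<alpha> \<beta> p \<theta> = liouville_factor \<alpha> \<beta> \<theta> * poly p (cos \<theta>)"

definition liouville' :: "real \<Rightarrow> real \<Rightarrow> real poly \<Rightarrow> real \<Rightarrow> real" where
  "liouville' \<alpha> \<beta> p \<theta> = liouville_factor \<alpha> \<beta> \<theta> *
     (liouville_logderiv \<alpha> \<beta> \<theta> * poly p (cos \<theta>) - sin \<theta> * poly (pderiv p) (cos \<theta>))"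

text \<open>
  The degree enters as a real parameter \<open>\<nu>\<close>, because the rescaled potential is going to be differentiated
  with respect to the reciprocal of the degree.
\<close>

definition jacobi_potential :: "real \<Rightarrow> real \<Rightarrow> real \<Rightarrow> real \<Rightarrow> real" where
  "jacobi_potential \<alpha> \<beta> \<nu> \<theta> = (\<nu> + (\<alpha> + \<beta> + 1) / 2)\<^sup>2
     + (1/4 - \<alpha>\<^sup>2) / (4 * (sin (\<theta> / 2))\<^sup>2) + (1/4 - \<beta>\<^sup>2) / (4 * (cos (\<theta> / 2))\<^sup>2)"

lemma half_angle_pos:
  assumes "\<theta> \<in> {0<..<pi}"
  shows "sin (\<theta> / 2) > 0" "cos (\<theta> / 2) > 0"
  using assms by (auto intro!: sin_gt_zero cos_gt_zero)

lemma liouville_factor_deriv: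
  assumes "\<theta> \<in> {0<..<pi}"
  shows "(liouville_factor \<alpha> \<beta> has_real_derivative
    liouville_logderiv \<alpha> \<beta> \<theta> * liouville_factor \<alpha> \<beta> \<theta>) (at \<theta>)"
proof -
  note pos = half_angle_pos[OF assms]
  have 1: "x powr (a - 1) = x powr a / x" if "x > 0" for x a :: real
    using that by (simp add: powr_diff)
  have "(liouville_factor \<alpha> \<beta> has_real_derivative
      ((\<alpha> + 1/2) * sin (\<theta>/2) powr (\<alpha> + 1/2 - 1) * (cos (\<theta>/2) / 2)) * cos (\<theta> / 2) powr (\<beta> + 1/2)
      + sin (\<theta>/2) powr (\<alpha> + 1/2) * ((\<beta> + 1/2) * cos (\<theta>/2) powr (\<beta> + 1/2 - 1) * (- sin (\<theta>/2) / 2))) (at \<theta>)"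
    unfolding liouville_factor_def[abs_def] using pos
    by (auto intro!: derivative_eq_intros)
  also have "((\<alpha> + 1/2) * sin (\<theta>/2) powr (\<alpha> + 1/2 - 1) * (cos (\<theta>/2) / 2)) * cos (\<theta> / 2) powr (\<beta> + 1/2)
      + sin (\<theta>/2) powr (\<alpha> + 1/2) * ((\<beta> + 1/2) * cos (\<theta>/2) powr (\<beta> + 1/2 - 1) * (- sin (\<theta>/2) / 2))
      = liouville_logderiv \<alpha> \<beta> \<theta> * liouville_factor \<alpha> \<beta> \<theta>"
    unfolding 1[OF pos(1)] 1[OF pos(2)] liouville_factor_def liouville_logderiv_def cot_def tan_def
    using pos by (simp add: field_simps)
  finally show ?thesis .
qed

lemma liouville_logderiv_deriv:
  assumes "\<theta> \<in> {0<..<pi}"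
  shows "(liouville_logderiv \<alpha> \<beta> has_real_derivative
    - (\<alpha> + 1/2) / (4 * (sin (\<theta>/2))\<^sup>2) - (\<beta> + 1/2) / (4 * (cos (\<theta>/2))\<^sup>2)) (at \<theta>)"
proof -
  have "((\<lambda>x. cot (x / 2)) has_real_derivative - (1 / (2 * (sin (\<theta>/2))\<^sup>2))) (at \<theta>)"
    using half_angle_pos[OF assms]
    by (intro DERIV_chain2[OF DERIV_cot, THEN DERIV_cong])
       (auto intro!: derivative_eq_intros simp: inverse_eq_divide)
  moreover have "((\<lambda>x. tan (x / 2)) has_real_derivative 1 / (2 * (cos (\<theta>/2))\<^sup>2)) (at \<theta>)"
    using half_angle_pos[OF assms]
    by (intro DERIV_chain2[OF DERIV_tan, THEN DERIV_cong])
       (auto intro!: derivative_eq_intros simp: inverse_eq_divide)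
  ultimately have "(liouville_logderiv \<alpha> \<beta> has_real_derivative
      ((\<alpha> + 1/2) * - (1 / (2 * (sin (\<theta>/2))\<^sup>2)) - (\<beta> + 1/2) * (1 / (2 * (cos (\<theta>/2))\<^sup>2))) / 2) (at \<theta>)"
    unfolding liouville_logderiv_def[abs_def] by (intro DERIV_cdivide DERIV_diff DERIV_cmult)
  then show ?thesis
    by (rule DERIV_cong) (use half_angle_pos[OF assms] in \<open>simp add: field_simps\<close>)
qed

lemma liouville_deriv:
  assumes "\<theta> \<in> {0<..<pi}"
  shows "(liouville \<alpha> \<beta> p has_real_derivative liouville' \<alpha> \<beta> p \<theta>) (at \<theta>)"
  unfolding liouville_def[abs_def] liouville'_def
  by (rule derivative_eq_intros liouville_factor_deriv[OF assms] refl)+ (simp add: algebra_simps)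

text \<open>
  If \<open>\<phi>' = \<psi> \<phi>\<close> then \<open>(\<phi> Y)'' = \<phi> (Y'' + 2 \<psi> Y' + (\<psi>' + \<psi>^2) Y)\<close>. For \<open>Y = p (cos \<theta>)\<close> the first two terms are
  \<open>- \<lambda> Y\<close> by the Jacobi equation, and \<open>\<psi>' + \<psi>^2\<close> has only the poles \<open>1/sin^2\<close> and \<open>1/cos^2\<close> in the half
  angle.
\<close>

lemma liouville_deriv2:
  assumes "\<theta> \<in> {0<..<pi}" and ode: "jacobi_op \<alpha> \<beta> p = smult (- jacobi_eigenvalue \<alpha> \<beta> n) p"
  shows "(liouville' \<alpha> \<beta> p has_real_derivative
    - jacobi_potential \<alpha> \<beta> (real n) \<theta> * liouville \<alpha> \<beta> p \<theta>) (at \<theta>)"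
proof -
  define S C where "S = sin (\<theta> / 2)" and "C = cos (\<theta> / 2)"
  have pos: "S > 0" "C > 0" using half_angle_pos[OF assms(1)] by (simp_all add: S_def C_def)
  have SC: "C\<^sup>2 = 1 - S\<^sup>2" unfolding S_def C_def by (rule cos_squared_eq)
  have \<theta>: "\<theta> = 2 * (\<theta> / 2)" by simp
  have sin: "sin \<theta> = 2 * S * C" unfolding S_def C_def by (subst \<theta>) (rule sin_double)
  have cos: "cos \<theta> = C\<^sup>2 - S\<^sup>2" unfolding S_def C_def by (subst \<theta>) (rule cos_double)
  define \<phi> \<psi> \<psi>' where "\<phi> = liouville_factor \<alpha> \<beta> \<theta>" and "\<psi> = liouville_logderiv \<alpha> \<beta> \<theta>"
    and "\<psi>' = - (\<alpha> + 1/2) / (4 * S\<^sup>2) - (\<beta> + 1/2) / (4 * C\<^sup>2)"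
  define y y' y'' where "y = poly p (cos \<theta>)" and "y' = poly (pderiv p) (cos \<theta>)"
    and "y'' = poly (pderiv (pderiv p)) (cos \<theta>)"
  have "(liouville' \<alpha> \<beta> p has_real_derivative
      \<psi> * \<phi> * (\<psi> * y - sin \<theta> * y') + \<phi> * (\<psi>' * y - \<psi> * (sin \<theta> * y') - cos \<theta> * y' + (sin \<theta>)\<^sup>2 * y'')) (at \<theta>)"
    unfolding liouville'_def[abs_def]
    by (rule derivative_eq_intros liouville_factor_deriv[OF assms(1)]
          liouville_logderiv_deriv[OF assms(1)] refl)+
       (simp add: \<phi>_def \<psi>_def \<psi>'_def y_def y'_def y''_def S_def C_def power2_eq_square algebra_simps)
  also have "\<psi> * \<phi> * (\<psi> * y - sin \<theta> * y') + \<phi> * (\<psi>' * y - \<psi> * (sin \<theta> * y') - cos \<theta> * y' + (sin \<theta>)\<^sup>2 * y'')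
      = \<phi> * ((\<psi>\<^sup>2 + \<psi>') * y + ((sin \<theta>)\<^sup>2 * y'' - (2 * \<psi> * sin \<theta> + cos \<theta>) * y'))"
    by (simp add: algebra_simps power2_eq_square)
  also have "2 * \<psi> * sin \<theta> + cos \<theta> = - (\<beta> - \<alpha> - (\<alpha> + \<beta> + 2) * cos \<theta>)"
  proof -
    have "2 * \<psi> * sin \<theta> = 2 * ((\<alpha> + 1/2) * C\<^sup>2 - (\<beta> + 1/2) * S\<^sup>2)"
      using pos unfolding sin \<psi>_def liouville_logderiv_def cot_def tan_def S_def[symmetric] C_def[symmetric]
      by (simp add: field_simps power2_eq_square)
    then show ?thesis unfolding cos SC by (simp add: algebra_simps)
  qed
  also have "(sin \<theta>)\<^sup>2 * y'' - - (\<beta> - \<alpha> - (\<alpha> + \<beta> + 2) * cos \<theta>) * y' = - jacobi_eigenvalue \<alpha> \<beta> n * y"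
    using jacobi_ode_cos[OF ode, of \<theta>]
    by (simp only: y_def y'_def y''_def mult_minus_left diff_minus_eq_add)
  also have "\<psi>\<^sup>2 + \<psi>' = jacobi_eigenvalue \<alpha> \<beta> n - jacobi_potential \<alpha> \<beta> (real n) \<theta>"
  proof -
    have \<psi>: "\<psi> = ((\<alpha> + 1/2) * (C / S) - (\<beta> + 1/2) * (S / C)) / 2"
      by (simp add: \<psi>_def liouville_logderiv_def cot_def tan_def S_def C_def)
    have CS: "C / S * (C / S) = 1 / S\<^sup>2 - 1" "S / C * (S / C) = 1 / C\<^sup>2 - 1" "C / S * (S / C) = 1"
      using pos SC by (simp_all add: field_simps power2_eq_square)
    have "\<psi>\<^sup>2 = ((\<alpha> + 1/2)\<^sup>2 * (C / S * (C / S)) + (\<beta> + 1/2)\<^sup>2 * (S / C * (S / C))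
        - 2 * (\<alpha> + 1/2) * (\<beta> + 1/2) * (C / S * (S / C))) / 4"
    proof -
      have "((a * u - b * v) / 2)\<^sup>2 = (a\<^sup>2 * (u * u) + b\<^sup>2 * (v * v) - 2 * a * b * (u * v)) / 4"
        for a b u v :: real by (simp add: power2_eq_square algebra_simps)
      then show ?thesis unfolding \<psi> .
    qed
    also have "\<dots> = ((\<alpha> + 1/2)\<^sup>2 * (1 / S\<^sup>2 - 1) + (\<beta> + 1/2)\<^sup>2 * (1 / C\<^sup>2 - 1)
        - 2 * (\<alpha> + 1/2) * (\<beta> + 1/2)) / 4"
      unfolding CS by simp
    finally have 1: "\<psi>\<^sup>2 = \<dots>" .
    have 2: "\<psi>' = - (\<alpha> + 1/2) / 4 * (1 / S\<^sup>2) - (\<beta> + 1/2) / 4 * (1 / C\<^sup>2)"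
      by (simp add: \<psi>'_def)
    have 3: "jacobi_potential \<alpha> \<beta> (real n) \<theta> = (real n + (\<alpha> + \<beta> + 1) / 2)\<^sup>2
        + (1/4 - \<alpha>\<^sup>2) / 4 * (1 / S\<^sup>2) + (1/4 - \<beta>\<^sup>2) / 4 * (1 / C\<^sup>2)"
      by (simp add: jacobi_potential_def S_def C_def)
    have "((\<alpha> + 1/2)\<^sup>2 * (u - 1) + (\<beta> + 1/2)\<^sup>2 * (v - 1) - 2 * (\<alpha> + 1/2) * (\<beta> + 1/2)) / 4
        + (- (\<alpha> + 1/2) / 4 * u - (\<beta> + 1/2) / 4 * v)
      = jacobi_eigenvalue \<alpha> \<beta> n
        - ((real n + (\<alpha> + \<beta> + 1) / 2)\<^sup>2 + (1/4 - \<alpha>\<^sup>2) / 4 * u + (1/4 - \<beta>\<^sup>2) / 4 * v)" for u v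
      unfolding jacobi_eigenvalue_def by (simp add: power2_eq_square field_simps)
    then show ?thesis unfolding 1 2 3 .
  qed
  finally show ?thesis by (simp add: liouville_def \<phi>_def y_def algebra_simps)
qed

lemma liouville_zero_iff:
  assumes "\<theta> \<in> {0<..<pi}"
  shows "liouville \<alpha> \<beta> p \<theta> = 0 \<longleftrightarrow> poly p (cos \<theta>) = 0"
  using half_angle_pos[OF assms] by (simp add: liouville_def liouville_factor_def)

lemma wronskian_factor_limit:
  fixes a s t :: real
  assumes "2 * a + 1 > 0" "s > 0" "t > 0"
  shows "((\<lambda>x. x * (sin (s * x / 2) powr a * sin (t * x / 2) powr a)) \<longlongrightarrow> 0) (at_right 0)"
  using assms by real_asymp

text \<open>
  The poles \<open>1/x\<close> of the two cotangent terms cancel, and the difference is of first order in \<open>x\<close>.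
\<close>

lemma logderiv_difference_limit:
  fixes a b s t :: real
  assumes "s > 0" "t > 0"
  shows "((\<lambda>x. (s * (a * cot (s * x / 2) - b * tan (s * x / 2)) / 2
      - t * (a * cot (t * x / 2) - b * tan (t * x / 2)) / 2) / x)
    \<longlongrightarrow> - (a / 12 + b / 4) * (s\<^sup>2 - t\<^sup>2)) (at_right 0)"
  using assms unfolding cot_def
  apply real_asymp
  apply (simp add: field_simps power2_eq_square)
  done

text \<open>
  After the Liouville factors are taken out, the remaining bracket is \<open>x\<close> times a function with a finite limit,
  and \<open>x\<close> times the product of the two factors is of order \<open>x powr (2 \<alpha> + 2)\<close>.
\<close>

lemma wronskian_limit_0:
  fixes s t :: real
  assumes "\<alpha> > -1" "s > 0" "t > 0"
  shows "((\<lambda>x. s * liouville' \<alpha> \<beta> p (s * x) * liouville \<alpha> \<beta> q (t * x)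
      - liouville \<alpha> \<beta> p (s * x) * (t * liouville' \<alpha> \<beta> q (t * x))) \<longlongrightarrow> 0) (at_right 0)"
proof -
  define a b where "a = \<alpha> + 1/2" and "b = \<beta> + 1/2"
  define A where "A x = x * (sin (s * x / 2) powr a * sin (t * x / 2) powr a)" for x
  define B where "B x = cos (s * x / 2) powr b * cos (t * x / 2) powr b" for x
  define D where "D x = (s * (a * cot (s * x / 2) - b * tan (s * x / 2)) / 2
      - t * (a * cot (t * x / 2) - b * tan (t * x / 2)) / 2) / x" for x
  define P P1 Q Q1 where "P x = poly p (cos (s * x))" and "P1 x = poly (pderiv p) (cos (s * x))"
    and "Q x = poly q (cos (t * x))" and "Q1 x = poly (pderiv q) (cos (t * x))" for x
  have A: "(A \<longlongrightarrow> 0) (at_right 0)"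
    unfolding A_def using assms by (intro wronskian_factor_limit) (auto simp: a_def)
  have B: "(B \<longlongrightarrow> 1) (at_right 0)"
    unfolding B_def by (auto intro!: tendsto_eq_intros)
  have D: "(D \<longlongrightarrow> - (a / 12 + b / 4) * (s\<^sup>2 - t\<^sup>2)) (at_right 0)"
    unfolding D_def using assms(2,3) by (rule logderiv_difference_limit)
  have poly: "((\<lambda>x. poly r (cos (c * x))) \<longlongrightarrow> poly r 1) (at_right 0)" for r :: "real poly" and c
    by (intro tendsto_eq_intros) auto
  have sin: "((\<lambda>x. sin (c * x) / x) \<longlongrightarrow> c) (at_right 0)" for c :: real
    by real_asymp
  have lim: "((\<lambda>x. A x * B x * (D x * P x * Q x - s * (sin (s * x) / x) * P1 x * Q x
      + t * (sin (t * x) / x) * P x * Q1 x)) \<longlongrightarrow>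
      0 * 1 * (- (a / 12 + b / 4) * (s\<^sup>2 - t\<^sup>2) * poly p 1 * poly q 1 - s * s * poly (pderiv p) 1 * poly q 1
      + t * t * poly p 1 * poly (pderiv q) 1)) (at_right 0)"
    unfolding P_def P1_def Q_def Q1_def by (intro tendsto_intros A B D poly sin)
  have "eventually (\<lambda>x. A x * B x * (D x * P x * Q x - s * (sin (s * x) / x) * P1 x * Q x
      + t * (sin (t * x) / x) * P x * Q1 x) = s * liouville' \<alpha> \<beta> p (s * x) * liouville \<alpha> \<beta> q (t * x)
      - liouville \<alpha> \<beta> p (s * x) * (t * liouville' \<alpha> \<beta> q (t * x))) (at_right 0)"
      using eventually_at_right_less[of 0]
    proof eventually_elim
      case (elim x)
      have D': "s * liouville_logderiv \<alpha> \<beta> (s * x) - t * liouville_logderiv \<alpha> \<beta> (t * x) = D x * x"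
        using elim by (simp add: D_def liouville_logderiv_def a_def b_def)
      have "s * liouville' \<alpha> \<beta> p (s * x) * liouville \<alpha> \<beta> q (t * x)
          - liouville \<alpha> \<beta> p (s * x) * (t * liouville' \<alpha> \<beta> q (t * x))
        = liouville_factor \<alpha> \<beta> (s * x) * liouville_factor \<alpha> \<beta> (t * x) *
          ((s * liouville_logderiv \<alpha> \<beta> (s * x) - t * liouville_logderiv \<alpha> \<beta> (t * x)) * P x * Q x
           - s * sin (s * x) * P1 x * Q x + t * sin (t * x) * P x * Q1 x)"
        by (simp add: liouville_def liouville'_def P_def P1_def Q_def Q1_def algebra_simps)
      also have "\<dots> = (x * (liouville_factor \<alpha> \<beta> (s * x) * liouville_factor \<alpha> \<beta> (t * x))) *
          (D x * P x * Q x - s * (sin (s * x) / x) * P1 x * Q x + t * (sin (t * x) / x) * P x * Q1 x)"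
        unfolding D' using elim by (simp add: field_simps)
      also have "x * (liouville_factor \<alpha> \<beta> (s * x) * liouville_factor \<alpha> \<beta> (t * x)) = A x * B x"
        by (simp add: liouville_factor_def A_def B_def a_def b_def)
      finally show ?case by simp
    qed
  from Lim_transform_eventually[OF lim this] show ?thesis by simp
qed

section \<open>Monotonicity of the rescaled potential\<close>

lemma mult_cos_less_sin:
  fixes t :: real
  assumes "0 < t" "t < pi"
  shows "t * cos t < sin t"
proof -
  define f where "f x = sin x - x * cos x" for x :: real
  have "f 0 < f t"
  proof (rule DERIV_pos_imp_increasing_open[OF assms(1)])
    fix x :: real assume x: "0 < x" "x < t"
    have "(f has_real_derivative x * sin x) (at x)"
      unfolding f_def by (auto intro!: derivative_eq_intros)
    moreover have "x * sin x > 0" using x assms by (auto intro!: mult_pos_pos sin_gt_zero)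
    ultimately show "\<exists>y. (f has_real_derivative y) (at x) \<and> y > 0" by blast
  qed (auto simp: f_def intro!: continuous_intros)
  then show ?thesis by (simp add: f_def)
qed

text \<open>
  The Pade bound \<open>arctan x \<ge> 3 x / (3 + x^2)\<close> for \<open>x \<ge> 0\<close>, at \<open>x = tan t\<close>.
\<close>

lemma three_tan_le:
  fixes t :: real
  assumes "0 \<le> t" "t < pi / 2"
  shows "3 * tan t \<le> t * (3 + (tan t)\<^sup>2)"
proof -
  define f where "f x = arctan x - 3 * x / (3 + x\<^sup>2)" for x :: real
  define T where "T = tan t"
  have "T \<ge> 0" using assms by (auto simp: T_def intro!: tan_pos_pi2_le)
  have pos: "3 + x\<^sup>2 > 0" for x :: real using zero_le_power2[of x] by linarith
  have "f 0 \<le> f T"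
  proof (rule DERIV_nonneg_imp_nondecreasing[OF \<open>T \<ge> 0\<close>])
    fix x :: real
    have "(f has_real_derivative 1 / (1 + x\<^sup>2) - (3 * (3 + x\<^sup>2) - 3 * x * (2 * x)) / (3 + x\<^sup>2)\<^sup>2) (at x)"
      unfolding f_def using pos[of x]
      by (auto intro!: derivative_eq_intros simp: power2_eq_square inverse_eq_divide)
    also have "1 / (1 + x\<^sup>2) - (3 * (3 + x\<^sup>2) - 3 * x * (2 * x)) / (3 + x\<^sup>2)\<^sup>2
        = 4 * x ^ 4 / ((1 + x\<^sup>2) * (3 + x\<^sup>2)\<^sup>2)"
    proof -
      have "1 + x\<^sup>2 \<noteq> 0" "3 + x\<^sup>2 \<noteq> 0" using pos[of x] by (auto simp: add_nonneg_eq_0_iff)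
      then show ?thesis by (simp add: divide_simps) algebra
    qed
    finally show "\<exists>y. (f has_real_derivative y) (at x) \<and> y \<ge> 0"
      by (intro exI conjI) (auto intro!: divide_nonneg_nonneg mult_nonneg_nonneg)
  qed
  moreover have "arctan T = t" using assms unfolding T_def by (intro arctan_tan) auto
  ultimately have "3 * T / (3 + T\<^sup>2) \<le> t" by (simp add: f_def)
  then show ?thesis using pos[of T] by (simp add: T_def field_simps)
qed

text \<open>
  Up to the factor \<open>2 r\<close>, with \<open>t = r x / 2\<close>, these are the derivatives of \<open>r^2 / sin^2 (r x / 2)\<close> and
  \<open>r^2 / cos^2 (r x / 2)\<close> with respect to \<open>r\<close>.
\<close>

definition sin_slope :: "real \<Rightarrow> real" where "sin_slope t = (1 - t * cot t) / (sin t)\<^sup>2"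
definition cos_slope :: "real \<Rightarrow> real" where "cos_slope t = (1 + t * tan t) / (cos t)\<^sup>2"

text \<open>
  With \<open>T = tan t\<close> everything becomes rational in \<open>t\<close> and \<open>T\<close>, and \<open>1 / cos^2 t = 1 + T^2\<close>.
\<close>

lemma slope_bounds:
  assumes t: "0 < t" "t < pi / 2"
  shows "0 < sin_slope t" "sin_slope t \<le> 1" "1 \<le> cos_slope t" "3 * sin_slope t \<le> cos_slope t"
proof -
  define T where "T = tan t"
  have s: "sin t > 0" and c: "cos t > 0" using t by (auto intro!: sin_gt_zero cos_gt_zero)
  have T: "T > 0" unfolding T_def using t by (rule tan_gt_zero)
  have c2: "1 / (cos t)\<^sup>2 = 1 + T\<^sup>2"
    using c by (simp add: T_def tan_def power_divide field_simps)
  have cs: "cos_slope t = (1 + t * T) * (1 + T\<^sup>2)"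
    unfolding cos_slope_def c2[symmetric] by (simp add: T_def)
  have ss: "sin_slope t = (1 - t / T) * (1 + T\<^sup>2) / T\<^sup>2"
    unfolding sin_slope_def c2[symmetric] using s c
    by (simp add: T_def tan_def cot_def power_divide field_simps)
  have "t < T" using mult_cos_less_sin[of t] t c by (simp add: T_def tan_def field_simps)
  then have "0 < 1 - t / T" using T by simp
  then show "0 < sin_slope t"
    unfolding ss using T by (intro divide_pos_pos mult_pos_pos add_pos_nonneg) auto
  have "sin t * cos t \<le> t"
    using sin_x_le_x[of "2 * t"] t by (simp add: sin_double)
  then have "1 - t * cot t \<le> (sin t)\<^sup>2"
  proof -
    have "sin t * cos t * cot t \<le> t * cot t"
      using \<open>sin t * cos t \<le> t\<close> s c by (intro mult_right_mono) (auto simp: cot_def)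
    moreover have "sin t * cos t * cot t = 1 - (sin t)\<^sup>2"
      using s cos_squared_eq[of t] by (simp add: cot_def power2_eq_square)
    ultimately show ?thesis by linarith
  qed
  then show "sin_slope t \<le> 1" unfolding sin_slope_def using s by simp
  show "1 \<le> cos_slope t" unfolding cs using T t by (intro mult_ge1_I) auto
  have "3 * (1 - t / T) \<le> T\<^sup>2 * (1 + t * T)"
  proof -
    have "3 * T - 3 * t \<le> t * T\<^sup>2" using three_tan_le[of t] t by (simp add: T_def algebra_simps)
    also have "\<dots> \<le> T * T\<^sup>2" using \<open>t < T\<close> by (intro mult_right_mono) auto
    also have "\<dots> \<le> T * T\<^sup>2 * (1 + t * T)" using t T mult_left_mono[of 1 "1 + t * T" "T * T\<^sup>2"] by simp
    finally have "T * (3 * (1 - t / T)) \<le> T * (T\<^sup>2 * (1 + t * T))"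
      using T by (simp add: right_diff_distrib mult_ac)
    then show ?thesis using T by simp
  qed
  then have "3 * (1 - t / T) / T\<^sup>2 \<le> 1 + t * T"
    using T by (simp add: divide_le_eq mult.commute)
  then have "3 * (1 - t / T) / T\<^sup>2 * (1 + T\<^sup>2) \<le> (1 + t * T) * (1 + T\<^sup>2)"
    by (rule mult_right_mono) simp
  then show "3 * sin_slope t \<le> cos_slope t"
    unfolding cs ss by (simp only: times_divide_eq_left times_divide_eq_right mult.assoc)
qed

text \<open>
  The derivative of the rescaled potential in its worst case \<open>s = 1\<close>, with \<open>h\<close> and \<open>g\<close> for the two slopes. For
  \<open>\<alpha> > 1/2\<close> the bound \<open>h \<le> 1\<close> suffices. For \<open>\<alpha> < -1/2\<close> the first term is bounded below by \<open>h\<close> times itself and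
  \<open>g\<close> by \<open>3 h\<close>, which leaves a polynomial inequality. The factor \<open>3\<close> is sharp: on the edge
  \<open>\<alpha> + \<beta> + 1 = 0\<close> the first term vanishes, and \<open>(\<alpha>^2 - 1/4) / (1/4 - \<beta>^2) = (1/2 - \<alpha>) / (3/2 + \<alpha>)\<close>
  tends to \<open>3\<close> as \<open>\<alpha>\<close> tends to \<open>-1\<close>.
\<close>

lemma potential_slope_pos:
  assumes D1: "(\<alpha>, \<beta>) \<in> D1"
    and "0 < h" "h \<le> 1" "1 \<le> g" "3 * h \<le> g"
  shows "0 < (\<alpha> + \<beta> + 1) * (\<alpha> + \<beta> + 3) + (1/4 - \<alpha>\<^sup>2) * h + (1/4 - \<beta>\<^sup>2) * g"
proof -
  have ab: "\<alpha> > -1" "- 1/2 \<le> \<beta>" "\<beta> \<le> 1/2" "\<alpha> + \<beta> + 1 \<ge> 0" "\<alpha> \<noteq> -1/2 \<or> \<beta> \<noteq> -1/2"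
    using D1 by (auto simp: D1_def)
  have b: "1/4 - \<beta>\<^sup>2 \<ge> 0"
    using mult_nonneg_nonneg[of "1/2 - \<beta>" "1/2 + \<beta>"] ab by (simp add: power2_eq_square algebra_simps)
  have bg: "(1/4 - \<beta>\<^sup>2) * g \<ge> 0" using b assms by (intro mult_nonneg_nonneg) auto
  consider "\<alpha> > 1/2" | "\<bar>\<alpha>\<bar> \<le> 1/2" | "\<alpha> < -1/2" by linarith
  then show ?thesis
  proof cases
    case 1
    have "(\<alpha> + 1/2) * (\<alpha> + 5/2) \<le> (\<alpha> + \<beta> + 1) * (\<alpha> + \<beta> + 3)"
      using 1 ab by (intro mult_mono) auto
    moreover have "1/4 - \<alpha>\<^sup>2 \<le> (1/4 - \<alpha>\<^sup>2) * h"
    proof -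
      have "1/4 - \<alpha>\<^sup>2 \<le> 0" using 1 mult_nonneg_nonneg[of "\<alpha> - 1/2" "\<alpha> + 1/2"] by (simp add: power2_eq_square algebra_simps)
      then show ?thesis using mult_left_mono_neg[OF \<open>h \<le> 1\<close>, of "1/4 - \<alpha>\<^sup>2"] by simp
    qed
    moreover have "(\<alpha> + 1/2) * (\<alpha> + 5/2) + (1/4 - \<alpha>\<^sup>2) = 3 * \<alpha> + 3/2"
      by (simp add: power2_eq_square field_simps)
    ultimately show ?thesis using bg 1 by linarith
  next
    case 2
    then have a: "1/4 - \<alpha>\<^sup>2 \<ge> 0"
      using mult_nonneg_nonneg[of "1/2 - \<alpha>" "1/2 + \<alpha>"] by (simp add: power2_eq_square algebra_simps)
    have ah: "(1/4 - \<alpha>\<^sup>2) * h \<ge> 0" using a assms by (intro mult_nonneg_nonneg) auto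
    have "\<alpha> + \<beta> + 1 > 0" using 2 ab by linarith
    then have "(\<alpha> + \<beta> + 1) * (\<alpha> + \<beta> + 3) > 0" by (intro mult_pos_pos) auto
    then show ?thesis using ah bg by linarith
  next
    case 3
    define d where "d = \<alpha> + \<beta> + 1"
    have "d * (d + 2) * h \<le> d * (d + 2)"
      using mult_left_mono[OF \<open>h \<le> 1\<close>, of "d * (d + 2)"] ab by (simp add: d_def)
    moreover have "(1/4 - \<beta>\<^sup>2) * (3 * h) \<le> (1/4 - \<beta>\<^sup>2) * g" using assms b by (intro mult_left_mono) auto
    moreover have "0 < d * (d + 2) + (1/4 - \<alpha>\<^sup>2) + 3 * (1/4 - \<beta>\<^sup>2)"
    proof -
      have "d * (d + 2) + (1/4 - \<alpha>\<^sup>2) + 3 * (1/4 - \<beta>\<^sup>2) = 2 * (\<alpha> * (\<beta> + 2) + 2 * \<beta> - \<beta>\<^sup>2 + 2)"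
        by (simp add: d_def power2_eq_square algebra_simps)
      \<comment> \<open>Of the two lower bounds on \<open>\<alpha>\<close>, \<open>\<alpha> > -1\<close> is the sharper one for \<open>\<beta> \<ge> 0\<close> and \<open>\<alpha> \<ge> - 1 - \<beta>\<close> for \<open>\<beta> \<le> 0\<close>.\<close>
      moreover have "0 < \<alpha> * (\<beta> + 2) + 2 * \<beta> - \<beta>\<^sup>2 + 2"
      proof (cases "\<beta> \<ge> 0")
        case True
        have "0 < (\<alpha> + 1) * (\<beta> + 2)" using ab by (intro mult_pos_pos) auto
        moreover have "0 \<le> \<beta> * (1 - \<beta>)" using True ab by (intro mult_nonneg_nonneg) auto
        ultimately show ?thesis by (simp add: power2_eq_square algebra_simps)
      next
        case False
        have "0 \<le> d * (\<beta> + 2)" using ab by (intro mult_nonneg_nonneg) (auto simp: d_def)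
        moreover have "0 < - \<beta> * (1 + 2 * \<beta>)" using False 3 ab by (intro mult_pos_pos) auto
        ultimately show ?thesis by (simp add: d_def power2_eq_square algebra_simps)
      qed
      ultimately show ?thesis by simp
    qed
    then have "0 < (d * (d + 2) + (1/4 - \<alpha>\<^sup>2) + 3 * (1/4 - \<beta>\<^sup>2)) * h"
      using assms by simp
    ultimately show ?thesis by (simp add: d_def algebra_simps)
  qed
qed

text \<open>
  For \<open>r = 1/n\<close> the equation in the variable \<open>x = n \<theta>\<close> has the potential \<open>r\<^sup>2 * jacobi_potential \<alpha> \<beta> (1/r) (r * x)\<close>. It
  increases with \<open>r\<close>, now taken as a continuous parameter.
\<close>

lemma scaled_potential_less:
  assumes D1: "(\<alpha>, \<beta>) \<in> D1" and st: "0 < t" "t < s" "s \<le> 1" and x: "0 < x" "s * x < pi"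
  shows "t\<^sup>2 * jacobi_potential \<alpha> \<beta> (1 / t) (t * x) < s\<^sup>2 * jacobi_potential \<alpha> \<beta> (1 / s) (s * x)"
proof -
  define c where "c = (\<alpha> + \<beta> + 1) / 2"
  define G where "G r = (1 + c * r)\<^sup>2 + (1/4 - \<alpha>\<^sup>2) / 4 * (r\<^sup>2 / (sin (r * x / 2))\<^sup>2)
      + (1/4 - \<beta>\<^sup>2) / 4 * (r\<^sup>2 / (cos (r * x / 2))\<^sup>2)" for r
  have G: "r\<^sup>2 * jacobi_potential \<alpha> \<beta> (1 / r) (r * x) = G r" if "r > 0" for r
  proof -
    have "r\<^sup>2 * (1 / r + c)\<^sup>2 = (1 + c * r)\<^sup>2"
      using that by (simp add: power_mult_distrib[symmetric] distrib_left mult.commute)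
    then show ?thesis by (simp add: G_def jacobi_potential_def distrib_left c_def mult.commute[of "r\<^sup>2"])
  qed
  have "G t < G s"
  proof (rule DERIV_pos_imp_increasing[OF \<open>t < s\<close>])
    fix r assume r: "t \<le> r" "r \<le> s"
    define y where "y = r * x / 2"
    have "r > 0" "r \<le> 1" using r st by auto
    have y: "0 < y" "y < pi / 2"
    proof -
      have "r * x \<le> s * x" using r x by (intro mult_right_mono) auto
      then show "0 < y" "y < pi / 2" using \<open>r > 0\<close> x unfolding y_def by (simp, linarith)
    qed
    then have pos: "sin y > 0" "cos y > 0" by (auto intro!: sin_gt_zero cos_gt_zero)
    have "((\<lambda>r. r\<^sup>2 / (sin (r * x / 2))\<^sup>2) has_real_derivative 2 * r * sin_slope y) (at r)"
    proof -
      have "((\<lambda>r. r\<^sup>2 / (sin (r * x / 2))\<^sup>2) has_real_derivative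
          (2 * r * (sin y)\<^sup>2 - r\<^sup>2 * (2 * sin y * (cos y * (x / 2)))) / ((sin y)\<^sup>2 * (sin y)\<^sup>2)) (at r)"
        using pos unfolding y_def by (auto intro!: derivative_eq_intros)
      also have "(2 * r * (sin y)\<^sup>2 - r\<^sup>2 * (2 * sin y * (cos y * (x / 2)))) / ((sin y)\<^sup>2 * (sin y)\<^sup>2)
          = 2 * r * ((sin y)\<^sup>2 - y * cos y * sin y) / ((sin y)\<^sup>2 * (sin y)\<^sup>2)"
        by (simp add: y_def power2_eq_square algebra_simps)
      also have "\<dots> = 2 * r * sin_slope y"
        using pos by (simp add: sin_slope_def cot_def field_simps power2_eq_square)
      finally show ?thesis .
    qed
    moreover have "((\<lambda>r. r\<^sup>2 / (cos (r * x / 2))\<^sup>2) has_real_derivative 2 * r * cos_slope y) (at r)"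
    proof -
      have "((\<lambda>r. r\<^sup>2 / (cos (r * x / 2))\<^sup>2) has_real_derivative
          (2 * r * (cos y)\<^sup>2 - r\<^sup>2 * (2 * cos y * (- sin y * (x / 2)))) / ((cos y)\<^sup>2 * (cos y)\<^sup>2)) (at r)"
        using pos unfolding y_def by (auto intro!: derivative_eq_intros)
      also have "(2 * r * (cos y)\<^sup>2 - r\<^sup>2 * (2 * cos y * (- sin y * (x / 2)))) / ((cos y)\<^sup>2 * (cos y)\<^sup>2)
          = 2 * r * ((cos y)\<^sup>2 + y * sin y * cos y) / ((cos y)\<^sup>2 * (cos y)\<^sup>2)"
        by (simp add: y_def power2_eq_square algebra_simps)
      also have "\<dots> = 2 * r * cos_slope y"
        using pos by (simp add: cos_slope_def tan_def field_simps power2_eq_square)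
      finally show ?thesis .
    qed
    moreover have "((\<lambda>r. (1 + c * r)\<^sup>2) has_real_derivative 2 * (1 + c * r) * c) (at r)"
      by (auto intro!: derivative_eq_intros)
    ultimately have "(G has_real_derivative 2 * (1 + c * r) * c
        + (1/4 - \<alpha>\<^sup>2) / 4 * (2 * r * sin_slope y) + (1/4 - \<beta>\<^sup>2) / 4 * (2 * r * cos_slope y)) (at r)"
      unfolding G_def[abs_def] by (intro DERIV_add DERIV_cmult)
    moreover have "0 < 2 * (1 + c * r) * c
        + (1/4 - \<alpha>\<^sup>2) / 4 * (2 * r * sin_slope y) + (1/4 - \<beta>\<^sup>2) / 4 * (2 * r * cos_slope y)"
    proof -
      have "c \<ge> 0" using D1 by (simp add: c_def D1_def)
      have "0 < r / 2 * ((\<alpha> + \<beta> + 1) * (\<alpha> + \<beta> + 3) + (1/4 - \<alpha>\<^sup>2) * sin_slope y + (1/4 - \<beta>\<^sup>2) * cos_slope y)"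
        using potential_slope_pos[OF D1 slope_bounds[OF y]] \<open>r > 0\<close> by simp
      also have "\<dots> = 2 * (r + c * r) * c
          + (1/4 - \<alpha>\<^sup>2) / 4 * (2 * r * sin_slope y) + (1/4 - \<beta>\<^sup>2) / 4 * (2 * r * cos_slope y)"
        by (simp add: c_def power2_eq_square field_simps)
      also have "2 * (r + c * r) * c \<le> 2 * (1 + c * r) * c"
        using \<open>r \<le> 1\<close> \<open>c \<ge> 0\<close> by (intro mult_right_mono) auto
      finally show ?thesis by simp
    qed
    ultimately show "\<exists>d. (G has_real_derivative d) (at r) \<and> d > 0" by blast
  qed
  then show ?thesis using G[of t] G[of s] st by simp
qed

section \<open>Comparison of the zeros for consecutive degrees\<close>

text \<open>
  Sturm's theorem in the stretched variable; \<open>l\<close> and \<open>r\<close> are consecutive zeros of \<open>q\<close>, or \<open>l = 0\<close> and \<open>r\<close> is the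
  first one. The bound on \<open>s * r\<close> keeps the interval in the range where the potentials are comparable.
\<close>

lemma scaled_zero_between:
  assumes D1: "(\<alpha>, \<beta>) \<in> D1" and st: "0 < t" "t < s" "s \<le> 1"
    and p: "jacobi_op \<alpha> \<beta> p = smult (- jacobi_eigenvalue \<alpha> \<beta> n) p" "s = 1 / real n"
    and q: "jacobi_op \<alpha> \<beta> q = smult (- jacobi_eigenvalue \<alpha> \<beta> m) q" "t = 1 / real m"
    and lr: "0 \<le> l" "l < r" "s * r < pi"
    and l: "l = 0 \<or> poly q (cos (t * l)) = 0" and r: "poly q (cos (t * r)) = 0"
    and no: "\<And>x. x \<in> {l<..<r} \<Longrightarrow> poly q (cos (t * x)) \<noteq> 0"
  shows "\<exists>x\<in>{l<..<r}. poly p (cos (s * x)) = 0"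
proof -
  have \<alpha>: "\<alpha> > -1" using D1 by (simp add: D1_def)
  let ?u = "\<lambda>c f x. liouville \<alpha> \<beta> f (c * x)" and ?u' = "\<lambda>c f x. c * liouville' \<alpha> \<beta> f (c * x)"
  let ?F = "\<lambda>c x. c\<^sup>2 * jacobi_potential \<alpha> \<beta> (1 / c) (c * x)"
  have rng: "s * x \<in> {0<..<pi}" "t * x \<in> {0<..<pi}" if "0 < x" "x \<le> r" for x
  proof -
    have "t * x < s * x" "s * x \<le> s * r" using that st by auto
    moreover have "0 < t * x" using that st by simp
    ultimately show "s * x \<in> {0<..<pi}" "t * x \<in> {0<..<pi}" using lr by auto
  qed
  have d1: "(?u c f has_real_derivative ?u' c f x) (at x)" if "c * x \<in> {0<..<pi}" for c f x
  proof -
    have "((\<lambda>x. c * x) has_real_derivative c) (at x)" by (auto intro!: derivative_eq_intros)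
    from DERIV_chain2[of "liouville \<alpha> \<beta> f" _ "\<lambda>x. c * x", OF liouville_deriv[OF that] this]
    show ?thesis by (simp add: mult.commute)
  qed
  have d2: "(?u' c f has_real_derivative - ?F c x * ?u c f x) (at x)"
    if "c * x \<in> {0<..<pi}" "jacobi_op \<alpha> \<beta> f = smult (- jacobi_eigenvalue \<alpha> \<beta> k) f" "c = 1 / real k" for c f x k
  proof -
    have "((\<lambda>x. liouville' \<alpha> \<beta> f (c * x)) has_real_derivative
        - jacobi_potential \<alpha> \<beta> (real k) (c * x) * liouville \<alpha> \<beta> f (c * x) * c) (at x)"
      by (rule DERIV_chain2[of "liouville' \<alpha> \<beta> f" _ "\<lambda>x. c * x", OF liouville_deriv2[OF that(1,2)]])
         (auto intro!: derivative_eq_intros)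
    from DERIV_cmult[OF this, of c] show ?thesis
      using that(3) by (simp add: power2_eq_square mult_ac)
  qed
  have "\<exists>x\<in>{l<..<r}. ?u s p x = 0"
  proof (rule sturm_comparison[where u' = "?u' s p" and v = "?u t q" and v' = "?u' t q"
        and F = "?F s" and G = "?F t"])
    show "l < r" by fact
    fix x assume x: "x \<in> {l<..r}"
    then have x': "0 < x" "x \<le> r" using lr by auto
    show "(?u s p has_real_derivative ?u' s p x) (at x)" by (rule d1[OF rng(1)[OF x']])
    show "(?u' s p has_real_derivative - ?F s x * ?u s p x) (at x)" by (rule d2[OF rng(1)[OF x'] p])
    show "(?u t q has_real_derivative ?u' t q x) (at x)" by (rule d1[OF rng(2)[OF x']])
    show "(?u' t q has_real_derivative - ?F t x * ?u t q x) (at x)" by (rule d2[OF rng(2)[OF x'] q])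
  next
    fix x assume x: "x \<in> {l<..<r}"
    then have x': "0 < x" "x \<le> r" using lr by auto
    show "?F t x < ?F s x"
      using rng(1)[OF x'] by (intro scaled_potential_less[OF D1 st x'(1)]) auto
    show "?u t q x \<noteq> 0" using no[OF x] liouville_zero_iff[OF rng(2)[OF x']] by simp
  next
    show "?u t q r = 0" using r by (simp add: liouville_def)
    show "((\<lambda>x. ?u' s p x * ?u t q x - ?u s p x * ?u' t q x) \<longlongrightarrow> 0) (at_right l) \<or>
      ?u t q l = 0 \<and> isCont (?u s p) l \<and> isCont (?u' s p) l \<and> isCont (?u' t q) l \<and>
      (?u t q has_real_derivative ?u' t q l) (at l)"
    proof (cases "l = 0")
      case True
      then show ?thesis using wronskian_limit_0[OF \<alpha>, of s t] st by simp
    next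
      case False
      then have l': "0 < l" "l \<le> r" using lr by auto
      have "?u t q l = 0" using False l by (simp add: liouville_def)
      show ?thesis
        using \<open>?u t q l = 0\<close> DERIV_isCont[OF d1[OF rng(1)[OF l']]] d1[OF rng(2)[OF l']]
          DERIV_isCont[OF d2[OF rng(1)[OF l'] p]] DERIV_isCont[OF d2[OF rng(2)[OF l'] q]]
        by blast
    qed
  qed
  then show ?thesis
    using liouville_zero_iff[OF rng(1)] lr by force
qed

text \<open>
  The form in which zeros are counted: \<open>k + 1\<close> elements below \<open>t\<close> bound the element with index \<open>k\<close>.
\<close>

lemma nth_sorted_list_of_set_less:
  fixes A :: "'a::linorder set"
  assumes "finite A" "B \<subseteq> A" "k < card B" "\<And>x. x \<in> B \<Longrightarrow> x < t"
  shows "sorted_list_of_set A ! k < t"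
proof (rule ccontr)
  let ?xs = "sorted_list_of_set A"
  assume ge: "\<not> ?xs ! k < t"
  have "B \<subseteq> (\<lambda>i. ?xs ! i) ` {..<k}"
  proof
    fix x assume "x \<in> B"
    then have "x \<in> set ?xs" "x < t" using assms by auto
    then obtain i where i: "i < length ?xs" "?xs ! i = x" by (auto simp: in_set_conv_nth)
    have "i < k"
    proof (rule ccontr)
      assume "\<not> i < k"
      then have "?xs ! k \<le> ?xs ! i" using i by (intro sorted_nth_mono) auto
      then show False using ge i \<open>x < t\<close> by auto
    qed
    then show "x \<in> (\<lambda>i. ?xs ! i) ` {..<k}" using i by auto
  qed
  then have "card B \<le> k" using surj_card_le[of "{..<k}" B] by simp
  then show False using assms(3) by simp
qed

theorem corollary5p3:
  fixes \<alpha> \<beta> :: real and n k :: nat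
  assumes "(\<alpha>, \<beta>) \<in> D1" and "n \<ge> 1" and "1 \<le> k" and "k \<le> n"
  shows "real n * jacobi_theta \<alpha> \<beta> n k < real (n + 1) * jacobi_theta \<alpha> \<beta> (n + 1) k"
proof -
  have ab: "\<alpha> > -1" "\<beta> > -1" using assms(1) by (auto simp: D1_def)
  let ?A = "jacobi_angles \<alpha> \<beta>"
  define s t where "s = 1 / real n" and "t = 1 / real (n + 1)"
  have st: "0 < t" "t < s" "s \<le> 1" using assms(2) by (auto simp: s_def t_def field_simps)
  define z where "z = sorted_list_of_set (?A (n + 1))"
  have z: "set z = ?A (n + 1)" "length z = n + 1" "sorted_wrt (<) z"
    using jacobi_angles_card[OF ab, of "n + 1"] by (auto simp: z_def)
  have zA: "z ! i \<in> ?A (n + 1)" if "i \<le> n" for i using that z by (metis Suc_eq_plus1 less_Suc_eq_le nth_mem)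
  have zless: "z ! i < z ! j" if "i < j" "j \<le> n" for i j
    using sorted_wrt_nth_less[OF z(3), of i j] that z(2) by simp
  \<comment> \<open>The zeros in the stretched variable, preceded by the endpoint \<open>0\<close>.\<close>
  define Z where "Z j = (if j = 0 then 0 else z ! (j - 1) / t)" for j
  have theta_m: "jacobi_theta \<alpha> \<beta> (n + 1) k = t * Z k"
    using assms(3) st by (simp add: jacobi_theta_def Z_def z_def jacobi_angles_def)
  have theta_n: "jacobi_theta \<alpha> \<beta> n k = sorted_list_of_set (?A n) ! (k - 1)"
    by (simp add: jacobi_theta_def jacobi_angles_def)
  have "jacobi_theta \<alpha> \<beta> n k < s * Z k"
  \<comment> \<open>Beyond this bound the claim follows from \<open>\<theta>_{n,k} < \<pi>\<close>.\<close>
  proof (cases "s * Z k < pi")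
    case False
    have "sorted_list_of_set (?A n) ! (k - 1) \<in> ?A n"
      using assms jacobi_angles_card[OF ab, of n] by (metis diff_less le_trans length_sorted_list_of_set less_le_trans nth_mem set_sorted_list_of_set zero_less_one)
    then show ?thesis using False by (auto simp: theta_n jacobi_angles_def)
  next
    case True
    have Zmono: "Z i < Z j" if "i < j" "j \<le> k" for i j
      using that zless[of "i - 1" "j - 1"] zA[of "j - 1"] assms st
      by (auto simp: Z_def jacobi_angles_def divide_strict_right_mono)
    have "\<exists>x\<in>{Z j<..<Z (Suc j)}. poly (jacobi_poly \<alpha> \<beta> n) (cos (s * x)) = 0" if j: "j < k" for j
    proof (rule scaled_zero_between[OF assms(1) st jacobi_poly_ode[OF ab] s_def jacobi_poly_ode[OF ab] t_def])
      show "0 \<le> Z j" using Zmono[of 0 j] j by (cases "j = 0") (auto simp: Z_def)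
      show "Z j < Z (Suc j)" using Zmono j by simp
      show "s * Z (Suc j) < pi"
      proof -
        have "Z (Suc j) \<le> Z k" using Zmono[of "Suc j" k] j by (cases "Suc j = k") auto
        then show ?thesis using True st by (smt (verit) mult_left_mono)
      qed
      show "Z j = 0 \<or> poly (jacobi_poly \<alpha> \<beta> (n + 1)) (cos (t * Z j)) = 0"
        using zA[of "j - 1"] j assms st by (auto simp: Z_def jacobi_angles_def)
      show "poly (jacobi_poly \<alpha> \<beta> (n + 1)) (cos (t * Z (Suc j))) = 0"
        using zA[of j] j assms st by (auto simp: Z_def jacobi_angles_def)
      fix x assume x: "x \<in> {Z j<..<Z (Suc j)}"
      show "poly (jacobi_poly \<alpha> \<beta> (n + 1)) (cos (t * x)) \<noteq> 0"
      proof
        assume 0: "poly (jacobi_poly \<alpha> \<beta> (n + 1)) (cos (t * x)) = 0"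
        have "t * x < z ! j" using x st by (simp add: Z_def field_simps)
        moreover have "z ! j < pi" using zA[of j] j assms by (simp add: jacobi_angles_def)
        moreover have "0 < x" using x \<open>0 \<le> Z j\<close> by auto
        ultimately have "t * x \<in> set z" using 0 st by (simp add: z(1) jacobi_angles_def)
        then obtain i where i: "i \<le> n" "z ! i = t * x" using z(2) by (auto simp: in_set_conv_nth less_Suc_eq_le)
        have "\<not> j < i" "i \<noteq> j" using zless[of j i] i \<open>t * x < z ! j\<close> by auto
        then have "i < j" by simp
        moreover have "z ! (j - 1) < t * x" if "j > 0" using x st that by (simp add: Z_def field_simps)
        ultimately show False using zless[of i "j - 1"] i j assms
          by (cases "i = j - 1") (auto, linarith)
      qed
    qed
    then obtain X where X: "\<And>j. j < k \<Longrightarrow> X j \<in> {Z j<..<Z (Suc j)}"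
      "\<And>j. j < k \<Longrightarrow> poly (jacobi_poly \<alpha> \<beta> n) (cos (s * X j)) = 0" by metis
    have Zle: "Z i \<le> Z j" if "i \<le> j" "j \<le> k" for i j using Zmono[of i j] that by (cases "i = j") auto
    have Xmono: "X i < X j" if "i < j" "j < k" for i j
      using X(1)[of i] X(1)[of j] Zle[of "Suc i" j] that by auto
    have "inj_on (\<lambda>j. s * X j) {..<k}"
      using Xmono st by (intro linorder_inj_onI) (auto, fastforce)
    then have card: "card ((\<lambda>j. s * X j) ` {..<k}) = k" by (simp add: card_image)
    have bounds: "0 < s * X j \<and> s * X j < s * Z k" if "j < k" for j
    proof -
      have "Z 0 = 0" by (simp add: Z_def)
      then have "0 < X j" "X j < Z k"
        using X(1)[OF that] Zle[of 0 j] Zle[of "Suc j" k] that by auto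
      then show ?thesis using st by simp
    qed
    show ?thesis
      unfolding theta_n
    proof (rule nth_sorted_list_of_set_less)
      show "finite (?A n)" by (rule jacobi_angles_card[OF ab])
      show "(\<lambda>j. s * X j) ` {..<k} \<subseteq> ?A n"
        using X(2) bounds True by (fastforce simp: jacobi_angles_def)
      show "k - 1 < card ((\<lambda>j. s * X j) ` {..<k})" using card assms(3) by simp
    qed (use bounds in auto)
  qed
  then have "real n * jacobi_theta \<alpha> \<beta> n k < Z k"
    using assms(2) by (simp add: s_def field_simps)
  also have "Z k = real (n + 1) * jacobi_theta \<alpha> \<beta> (n + 1) k"
    unfolding theta_m by (simp add: t_def field_simps)
  finally show ?thesis .
qed

end
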